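(* Let $(\theta,\rho)$ be the global solution of the flow (F) with admissible initial datum $(\theta_0,\rho_0)$. Suppose that $\theta_0$ describes an embedded curve with rotation index $\omega=1$ and that $(\theta_0,\rho_0)$ satisfies $$\mathcal{E}_\mu(\theta_0,\rho_0)\le\frac{\inf_{\mathbb{R}}\beta}{2}\Big(\frac{C_{2T}}{L}-4\pi c_0+Lc_0^2\Big).$$ Then $\theta(t,\cdot)$ describes an embedded curve for all $t>0$.
   Context: Fixed parameters: $L>0$, $\nu\in\mathbb{R}$, $\mu>0$, $\omega\in\mathbb{Z}$, $c_0\in\mathbb{R}$, and $\beta\in C^\infty(\mathbb{R})$ with $\beta>0$. A function $\theta:[0,L]\to\mathbb{R}$ is the inclination angle of (describes) the arc-length parametrized planar curve $\gamma(s)=\gamma(0)+\int_0^s(\cos\theta,\sin\theta)\,\mathrm{d}r$, with curvature $\kappa=\partial_s\theta$; the closed curve is embedded if $\gamma$ is injective on $[0,L)$. $\rho:[0,L]\to\mathbb{R}$ is a density. The energy is $\mathcal{E}_\mu(\theta,\rho)=\frac12\int_0^L\big(\beta(\rho)(\partial_s\theta-c_0)^2+\mu(\partial_s\rho)^2\big)\,\mathrm{d}s$. The constant $C_{2T}\approx146.628$ is the one of Miura, Müller and Rupp ("Optimal thresholds for preserving embeddedness of elastic flows", Theorem 1.1), namely the scale-invariant bending energy $\mathrm{Length}(\gamma)\cdot\int_\gamma\kappa^2\,\mathrm{d}s$ of the elastic two-teardrop; equivalently, it is the minimum of $\mathrm{Length}(\gamma)\int_\gamma\kappa^2\,\mathrm{d}s$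 over all closed immersed planar $W^{2,2}$-curves $\gamma$ with rotation index $\pm1$ that are not embedded. The flow (F) is the initial boundary value problem $$\partial_t\theta=\partial_s\big(\beta(\rho)(\partial_s\theta-c_0)\big)+\lambda_{\theta1}\sin\theta-\lambda_{\theta2}\cos\theta,\qquad \partial_t\rho=\mu\,\partial_s^2\rho-\tfrac12\beta'(\rho)(\partial_s\theta-c_0)^2-\lambda_\rho$$ on $(0,T)\times[0,L]$, with boundary conditions $\theta(\cdot,L)-\theta(\cdot,0)=2\pi\omega$, $\rho(\cdot,L)=\rho(\cdot,0)$, $\partial_s\theta(\cdot,L)=\partial_s\theta(\cdot,0)$, $\partial_s\rho(\cdot,L)=\partial_s\rho(\cdot,0)$, and initial condition $(\theta,\rho)(0,\cdot)=(\theta_0,\rho_0)$. The nonlocal multipliers are $$\begin{pmatrix}\lambda_{\theta1}\\ \lambda_{\theta2}\end{pmatrix}(t)=\Pi^{-1}(\theta)\int_0^L\begin{pmatrix}\cos\theta\\ \sin\theta\end{pmatrix}\partial_s\theta\,\beta(\rho)(\partial_s\theta-c_0)\,\mathrm{d}s,\quad \Pi(\theta)=\begin{pmatrix}\int_0^L\sin^2\theta\,\mathrm{d}s&-\int_0^L\cos\theta\sin\theta\,\mathrm{d}s\\-\int_0^L\cos\theta\sin\theta\,\mathrm{d}s&\int_0^L\cos^2\theta\,\mathrm{d}s\end{pmatrix},$$ $\lambda_\rho(t)=-\frac1{2L}\int_0^L\beta'(\rho)(\partial_s\theta-c_0)^2\,\mathrm{d}s$. An admissible initial datum is $(\theta_0,\rho_0)\in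 C^\infty([0,L])$ with $\int_0^L\rho_0\,\mathrm{d}s=\nu L$, $\int_0^L\sin\theta_0\,\mathrm{d}s=\int_0^L\cos\theta_0\,\mathrm{d}s=0$, $\theta_0(L)-\theta_0(0)=2\pi\omega$, $\rho_0(L)=\rho_0(0)$, and $\partial_s^j\theta_0(L)=\partial_s^j\theta_0(0)$, $\partial_s^j\rho_0(L)=\partial_s^j\rho_0(0)$ for $j=1,2$. By earlier work, for each admissible initial datum (F) has a unique global solution $(\theta,\rho)\in C^\infty((0,\infty)\times[0,L])\cap C^0([0,\infty);C^2([0,L]))$; for $t>0$ the functions $\partial_s\theta(t,\cdot)$ and $\rho(t,\cdot)$ extend to smooth $L$-periodic functions on $\mathbb{R}$. *)

theory Defs
  imports "HOL-Analysis.Analysis"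
begin

section \<open>Function spaces\<close>

definition smooth_real :: "(real \<Rightarrow> real) \<Rightarrow> bool" where
  "smooth_real f \<longleftrightarrow> (\<forall>n x. ((deriv ^^ n) f) differentiable (at x))"

text \<open>Derivative in the space variable on \<^term>\<open>{0..L}\<close>; it is one-sided at the two endpoints.\<close>

definition ds :: "real \<Rightarrow> (real \<Rightarrow> real) \<Rightarrow> real \<Rightarrow> real" where
  "ds L f s = vector_derivative f (at s within {0..L})"

definition smooth_interval :: "real \<Rightarrow> (real \<Rightarrow> real) \<Rightarrow> bool" where
  "smooth_interval L f \<longleftrightarrow> (\<forall>n. \<forall>s\<in>{0..L}. ((ds L ^^ n) f) differentiable (at s within {0..L}))"

definition C2_interval :: "real \<Rightarrow> (real \<Rightarrow> real) \<Rightarrow> bool" where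
  "C2_interval L f \<longleftrightarrow>
     (\<forall>j<2. \<forall>s\<in>{0..L}. ((ds L ^^ j) f) differentiable (at s within {0..L})) \<and>
     continuous_on {0..L} ((ds L ^^ 2) f)"

text \<open>
  \<open>C\<^sup>\<infinity>((0,\<infinity>) \<times> [0,L])\<close>: all mixed partial derivatives exist and are continuous up to
  the lateral boundary; \<open>D j k\<close> is the derivative of order \<open>j\<close> in time and \<open>k\<close> in space.
\<close>

definition smooth_spacetime :: "real \<Rightarrow> (real \<Rightarrow> real \<Rightarrow> real) \<Rightarrow> bool" where
  "smooth_spacetime L f \<longleftrightarrow>
     (\<exists>D :: nat \<Rightarrow> nat \<Rightarrow> real \<Rightarrow> real \<Rightarrow> real.
        (\<forall>t>0. \<forall>s\<in>{0..L}. D 0 0 t s = f t s) \<and>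
        (\<forall>j k. continuous_on ({0<..} \<times> {0..L}) (\<lambda>(t, s). D j k t s)) \<and>
        (\<forall>j k. \<forall>t>0. \<forall>s\<in>{0..L}.
           ((\<lambda>\<tau>. D j k \<tau> s) has_real_derivative D (Suc j) k t s) (at t) \<and>
           ((\<lambda>\<sigma>. D j k t \<sigma>) has_real_derivative D j (Suc k) t s) (at s within {0..L})))"

text \<open>
  \<open>C\<^sup>0([0,\<infinity>); C\<^sup>2([0,L]))\<close>: continuity in the \<open>C\<^sup>2\<close> norm is uniform convergence on
  \<open>[0,L]\<close> of the derivatives of order at most two.
\<close>

definition C0_C2 :: "real \<Rightarrow> (real \<Rightarrow> real \<Rightarrow> real) \<Rightarrow> bool" where
  "C0_C2 L f \<longleftrightarrow>
     (\<forall>t\<ge>0. C2_interval L (f t)) \<and>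
     (\<forall>j\<le>2. \<forall>t\<ge>0. uniform_limit {0..L} (\<lambda>\<tau>. (ds L ^^ j) (f \<tau>)) ((ds L ^^ j) (f t))
                        (at t within {0..}))"


section \<open>Curves described by an inclination angle\<close>

text \<open>The plane is identified with the complex numbers, so \<open>(cos \<theta>, sin \<theta>)\<close> is \<^term>\<open>cis \<theta>\<close>.\<close>

definition curve_of :: "complex \<Rightarrow> (real \<Rightarrow> real) \<Rightarrow> real \<Rightarrow> complex" where
  "curve_of p \<theta> s = p + integral {0..s} (\<lambda>r. cis (\<theta> r))"

definition describes_embedded :: "real \<Rightarrow> (real \<Rightarrow> real) \<Rightarrow> bool" where
  "describes_embedded L \<theta> \<longleftrightarrow>
     (\<forall>p. curve_of p \<theta> L = curve_of p \<theta> 0 \<and> inj_on (curve_of p \<theta>) {0..<L})"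


section \<open>The two-teardrop constant\<close>

text \<open>
  \<open>closed_W22_immersion \<gamma> v a\<close>: \<open>\<gamma>\<close> is a closed immersed curve of class \<open>W\<^sup>2\<^sup>,\<^sup>2\<close> over the circle
  \<open>\<real>/\<int>\<close>, with derivative \<open>v\<close> and weak second derivative \<open>a\<close>. Thus \<open>v\<close> is the (absolutely
  continuous) primitive of the square-integrable function \<open>a\<close>, which is only determined up to
  null sets; the functionals below do not depend on its choice.
\<close>

definition closed_W22_immersion ::
  "(real \<Rightarrow> complex) \<Rightarrow> (real \<Rightarrow> complex) \<Rightarrow> (real \<Rightarrow> complex) \<Rightarrow> bool" where
  "closed_W22_immersion \<gamma> v a \<longleftrightarrow>
     (\<forall>x\<in>{0..1}. (\<gamma> has_vector_derivative v x) (at x within {0..1})) \<and>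
     a absolutely_integrable_on {0..1} \<and>
     (\<lambda>x. (norm (a x))\<^sup>2) absolutely_integrable_on {0..1} \<and>
     (\<forall>x\<in>{0..1}. v x = v 0 + integral {0..x} a) \<and>
     (\<forall>x\<in>{0..1}. v x \<noteq> 0) \<and>
     \<gamma> 1 = \<gamma> 0 \<and> v 1 = v 0"

text \<open>\<^term>\<open>Im (cnj v * a)\<close> is the determinant of the pair of plane vectors \<open>(v, a)\<close>.\<close>

definition signed_curvature :: "(real \<Rightarrow> complex) \<Rightarrow> (real \<Rightarrow> complex) \<Rightarrow> real \<Rightarrow> real" where
  "signed_curvature v a x = Im (cnj (v x) * a x) / norm (v x) ^ 3"

definition curve_length :: "(real \<Rightarrow> complex) \<Rightarrow> real" where
  "curve_length v = integral {0..1} (\<lambda>x. norm (v x))"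

definition bending_energy :: "(real \<Rightarrow> complex) \<Rightarrow> (real \<Rightarrow> complex) \<Rightarrow> real" where
  "bending_energy v a = integral {0..1} (\<lambda>x. (signed_curvature v a x)\<^sup>2 * norm (v x))"

definition rotation_index :: "(real \<Rightarrow> complex) \<Rightarrow> (real \<Rightarrow> complex) \<Rightarrow> real" where
  "rotation_index v a = integral {0..1} (\<lambda>x. signed_curvature v a x * norm (v x)) / (2 * pi)"

text \<open>
  The infimum is attained, by the elastic two-teardrop, by the theorem of Miura, Mueller and
  Rupp (Optimal thresholds for preserving embeddedness of elastic flows); its value is
  approximately 146.628.
\<close>

definition C2T :: real where
  "C2T = Inf {curve_length v * bending_energy v a | \<gamma> v a.
                closed_W22_immersion \<gamma> v a \<and>
                (rotation_index v a = 1 \<or> rotation_index v a = -1) \<and>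
                \<not> inj_on \<gamma> {0..<1}}"


section \<open>Energy and flow\<close>

definition energy ::
  "real \<Rightarrow> real \<Rightarrow> real \<Rightarrow> (real \<Rightarrow> real) \<Rightarrow> (real \<Rightarrow> real) \<Rightarrow> (real \<Rightarrow> real) \<Rightarrow> real" where
  "energy L \<mu> c0 \<beta> \<theta> \<rho> =
     1 / 2 * integral {0..L} (\<lambda>s. \<beta> (\<rho> s) * (ds L \<theta> s - c0)\<^sup>2 + \<mu> * (ds L \<rho> s)\<^sup>2)"

definition Pi_matrix :: "real \<Rightarrow> (real \<Rightarrow> real) \<Rightarrow> real^2^2" where
  "Pi_matrix L \<theta> =
     vector [vector [integral {0..L} (\<lambda>s. (sin (\<theta> s))\<^sup>2),
                     - integral {0..L} (\<lambda>s. cos (\<theta> s) * sin (\<theta> s))],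
             vector [- integral {0..L} (\<lambda>s. cos (\<theta> s) * sin (\<theta> s)),
                     integral {0..L} (\<lambda>s. (cos (\<theta> s))\<^sup>2)]]"

definition lambda_theta ::
  "real \<Rightarrow> real \<Rightarrow> (real \<Rightarrow> real) \<Rightarrow> (real \<Rightarrow> real) \<Rightarrow> (real \<Rightarrow> real) \<Rightarrow> real^2" where
  "lambda_theta L c0 \<beta> \<theta> \<rho> =
     matrix_inv (Pi_matrix L \<theta>) *v
       integral {0..L} (\<lambda>s. (ds L \<theta> s * \<beta> (\<rho> s) * (ds L \<theta> s - c0)) *\<^sub>R
                              (vector [cos (\<theta> s), sin (\<theta> s)] :: real^2))"

definition lambda_rho ::
  "real \<Rightarrow> real \<Rightarrow> (real \<Rightarrow> real) \<Rightarrow> (real \<Rightarrow> real) \<Rightarrow> (real \<Rightarrow> real) \<Rightarrow> real" where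
  "lambda_rho L c0 \<beta> \<theta> \<rho> =
     - (1 / (2 * L)) * integral {0..L} (\<lambda>s. deriv \<beta> (\<rho> s) * (ds L \<theta> s - c0)\<^sup>2)"

definition admissible_datum ::
  "real \<Rightarrow> real \<Rightarrow> int \<Rightarrow> (real \<Rightarrow> real) \<Rightarrow> (real \<Rightarrow> real) \<Rightarrow> bool" where
  "admissible_datum L \<nu> \<omega> \<theta>0 \<rho>0 \<longleftrightarrow>
     smooth_interval L \<theta>0 \<and> smooth_interval L \<rho>0 \<and>
     integral {0..L} \<rho>0 = \<nu> * L \<and>
     integral {0..L} (\<lambda>s. sin (\<theta>0 s)) = 0 \<and>
     integral {0..L} (\<lambda>s. cos (\<theta>0 s)) = 0 \<and>
     \<theta>0 L - \<theta>0 0 = 2 * pi * of_int \<omega> \<and>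
     \<rho>0 L = \<rho>0 0 \<and>
     (\<forall>j\<in>{1, 2}. (ds L ^^ j) \<theta>0 L = (ds L ^^ j) \<theta>0 0 \<and>
                 (ds L ^^ j) \<rho>0 L = (ds L ^^ j) \<rho>0 0)"

definition global_solution ::
  "real \<Rightarrow> real \<Rightarrow> int \<Rightarrow> real \<Rightarrow> (real \<Rightarrow> real) \<Rightarrow> (real \<Rightarrow> real) \<Rightarrow> (real \<Rightarrow> real) \<Rightarrow>
   (real \<Rightarrow> real \<Rightarrow> real) \<Rightarrow> (real \<Rightarrow> real \<Rightarrow> real) \<Rightarrow> bool" where
  "global_solution L \<mu> \<omega> c0 \<beta> \<theta>0 \<rho>0 \<theta> \<rho> \<longleftrightarrow>
     smooth_spacetime L \<theta> \<and> smooth_spacetime L \<rho> \<and> C0_C2 L \<theta> \<and> C0_C2 L \<rho> \<and>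
     (\<forall>t>0. \<forall>s\<in>{0..L}.
        deriv (\<lambda>\<tau>. \<theta> \<tau> s) t =
          ds L (\<lambda>\<sigma>. \<beta> (\<rho> t \<sigma>) * (ds L (\<theta> t) \<sigma> - c0)) s
          + lambda_theta L c0 \<beta> (\<theta> t) (\<rho> t) $ 1 * sin (\<theta> t s)
          - lambda_theta L c0 \<beta> (\<theta> t) (\<rho> t) $ 2 * cos (\<theta> t s) \<and>
        deriv (\<lambda>\<tau>. \<rho> \<tau> s) t =
          \<mu> * (ds L ^^ 2) (\<rho> t) s
          - 1 / 2 * deriv \<beta> (\<rho> t s) * (ds L (\<theta> t) s - c0)\<^sup>2
          - lambda_rho L c0 \<beta> (\<theta> t) (\<rho> t)) \<and>
     (\<forall>t>0. \<theta> t L - \<theta> t 0 = 2 * pi * of_int \<omega> \<and>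
            \<rho> t L = \<rho> t 0 \<and>
            ds L (\<theta> t) L = ds L (\<theta> t) 0 \<and>
            ds L (\<rho> t) L = ds L (\<rho> t) 0) \<and>
     (\<forall>s\<in>{0..L}. \<theta> 0 s = \<theta>0 s \<and> \<rho> 0 s = \<rho>0 s)"

end

theory Submission
  imports Defs
begin

text \<open>
  The flow is the constrained \<open>L\<^sup>2\<close> gradient flow of the energy: the multipliers keep
  \<open>\<integral> cos \<theta>\<close> and \<open>\<integral> sin \<theta>\<close>, hence the closedness of the curve,
  and the energy decays at the rate \<open>\<integral> (\<partial>\<^sub>t \<theta>)\<^sup>2 + \<integral> (\<partial>\<^sub>t \<rho>)\<^sup>2\<close>.
  If the closed curve at some time \<open>t > 0\<close> were not embedded, it would be a competitor for
  \<open>C2T\<close>; expanding \<open>(\<kappa> - c0)\<^sup>2\<close> with \<open>\<integral> \<kappa> = 2 \<pi>\<close> then bounds the energy at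
  time \<open>t\<close> from below by the threshold, that is, by the initial energy. So the energy is constant
  on \<open>[0, t]\<close>, the solution is stationary there, and the curve at time \<open>t\<close> is the embedded
  initial one, a contradiction. In particular equality in the threshold needs no separate treatment.
\<close>

section \<open>Curves and the bending threshold\<close>

lemma ds_eqI:
  assumes "0 < L" "s \<in> {0..L}" "(f has_real_derivative d) (at s within {0..L})"
  shows "ds L f s = d"
  unfolding ds_def
  by (rule vector_derivative_within_closed_interval)
     (use assms in \<open>auto simp: has_real_derivative_iff_has_vector_derivative\<close>)

lemma ds_cong:
  assumes "s \<in> {0..L}" "\<And>r. r \<in> {0..L} \<Longrightarrow> f r = g r"
  shows "ds L f s = ds L g s"
  unfolding ds_def by (rule vector_derivative_cong_eq) (use assms in auto)

text \<open>Only the product \<open>u * v\<close> has to agree at the two ends. This fits the flow,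
  where the angle itself jumps by a multiple of 2 pi while the flux, the sine, the cosine and the
  time derivatives are periodic.\<close>

lemma integral_by_parts_periodic:
  fixes u v :: "real \<Rightarrow> real"
  assumes "a \<le> b"
    and du: "\<And>s. s \<in> {a..b} \<Longrightarrow> (u has_real_derivative u' s) (at s within {a..b})"
    and dv: "\<And>s. s \<in> {a..b} \<Longrightarrow> (v has_real_derivative v' s) (at s within {a..b})"
    and cu: "continuous_on {a..b} u'" and cv: "continuous_on {a..b} v'"
    and bd: "u b * v b = u a * v a"
  shows "integral {a..b} (\<lambda>s. u' s * v s) = - integral {a..b} (\<lambda>s. u s * v' s)"
proof -
  have cont: "continuous_on {a..b} u" "continuous_on {a..b} v"
    using DERIV_continuous_on[of "{a..b}" u u'] DERIV_continuous_on[of "{a..b}" v v'] du dv by auto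
  have "((\<lambda>s. u' s * v s + u s * v' s) has_integral (u b * v b - u a * v a)) {a..b}"
    using \<open>a \<le> b\<close>
  proof (rule fundamental_theorem_of_calculus)
    fix s assume "s \<in> {a..b}"
    from DERIV_mult[OF du[OF this] dv[OF this]]
    show "((\<lambda>s. u s * v s) has_vector_derivative u' s * v s + u s * v' s) (at s within {a..b})"
      by (simp add: has_real_derivative_iff_has_vector_derivative[symmetric] algebra_simps)
  qed
  moreover have "((\<lambda>s. u' s * v s + u s * v' s) has_integral
      (integral {a..b} (\<lambda>s. u' s * v s) + integral {a..b} (\<lambda>s. u s * v' s))) {a..b}"
    by (intro has_integral_add integrable_integral integrable_continuous_interval
        continuous_intros cont cu cv)
  ultimately have "integral {a..b} (\<lambda>s. u' s * v s) + integral {a..b} (\<lambda>s. u s * v' s) = u b * v b - u a * v a"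
    by (rule has_integral_unique[symmetric])
  then show ?thesis
    using bd by simp
qed

lemma curve_of_eq: "curve_of p \<theta> s = p + curve_of 0 \<theta> s"
  by (simp add: curve_of_def)

lemma closed_curve_iff:
  assumes "0 < L" "continuous_on {0..L} \<theta>"
  shows "curve_of p \<theta> L = curve_of p \<theta> 0 \<longleftrightarrow>
    integral {0..L} (\<lambda>s. cos (\<theta> s)) = 0 \<and> integral {0..L} (\<lambda>s. sin (\<theta> s)) = 0"
proof -
  have i: "(\<lambda>r. cis (\<theta> r)) integrable_on {0..L}"
    by (intro integrable_continuous_interval continuous_intros assms)
  have "Re (integral {0..L} (\<lambda>r. cis (\<theta> r))) = integral {0..L} (\<lambda>s. cos (\<theta> s))"
       "Im (integral {0..L} (\<lambda>r. cis (\<theta> r))) = integral {0..L} (\<lambda>s. sin (\<theta> s))"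
    using integral_linear[OF i bounded_linear_Re] integral_linear[OF i bounded_linear_Im]
    by (simp_all add: o_def)
  then show ?thesis
    by (auto simp: curve_of_def complex_eq_iff)
qed

lemma describes_embedded_iff:
  "describes_embedded L \<theta> \<longleftrightarrow>
     curve_of 0 \<theta> L = curve_of 0 \<theta> 0 \<and> inj_on (curve_of 0 \<theta>) {0..<L}"
  \<comment> \<open>Translations preserve closedness and injectivity. Only the four occurrences with
    the bound base point are moved to the origin, since \<open>curve_of_eq\<close> matches its own
    right-hand side and would loop.\<close>
  unfolding describes_embedded_def inj_on_def
  by (subst (1 2 3 4) curve_of_eq) simp

lemma describes_embedded_cong:
  assumes "0 < L" "\<And>s. s \<in> {0..L} \<Longrightarrow> \<theta> s = \<theta>' s"
  shows "describes_embedded L \<theta> = describes_embedded L \<theta>'"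
proof -
  have "curve_of p \<theta> s = curve_of p \<theta>' s" if "s \<in> {0..L}" for p s
    using assms that by (auto simp: curve_of_def intro!: integral_cong)
  then show ?thesis
    using \<open>0 < L\<close> unfolding describes_embedded_def by (auto simp: inj_on_def)
qed

text \<open>Rescaled to the unit interval, the curve has constant speed \<open>L\<close> and becomes
  a competitor in the infimum defining \<open>C2T\<close>. The winding condition makes its rotation
  index 1, and its length times its bending energy is the right-hand side.\<close>

lemma C2T_le_length_bending:
  assumes L: "0 < L"
    and d\<theta>: "\<And>s. s \<in> {0..L} \<Longrightarrow> (\<theta> has_real_derivative \<kappa> s) (at s within {0..L})"
    and c\<kappa>: "continuous_on {0..L} \<kappa>"
    and winding: "\<theta> L - \<theta> 0 = 2 * pi"
    and closed: "curve_of 0 \<theta> L = curve_of 0 \<theta> 0"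
    and not_inj: "\<not> inj_on (curve_of 0 \<theta>) {0..<L}"
  shows "C2T \<le> L * integral {0..L} (\<lambda>s. (\<kappa> s)\<^sup>2)"
proof -
  define \<gamma> where "\<gamma> x = curve_of 0 \<theta> (L * x)" for x
  define v where "v x = of_real L * cis (\<theta> (L * x))" for x
  \<comment> \<open>One factor \<open>L\<close> is the speed, the other comes from the chain rule
    when \<open>v\<close> is differentiated.\<close>
  define a where "a x = of_real (L\<^sup>2 * \<kappa> (L * x)) * (\<i> * cis (\<theta> (L * x)))" for x
  have c\<theta>: "continuous_on {0..L} \<theta>"
    using DERIV_continuous_on[of "{0..L}" \<theta> \<kappa>] d\<theta> by auto
  have maps: "(\<lambda>x. L * x) ` {0..1} \<subseteq> {0..L}"
    using L by (auto simp: mult_le_cancel_left1)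
  have in_L: "L * x \<in> {0..L}" if "x \<in> {0..1}" for x
    using maps that by blast
  have dL: "((\<lambda>x. L * x) has_vector_derivative L) (at x within {0..1})" for x
    by (auto intro!: derivative_eq_intros)
  \<comment> \<open>The Jacobian \<open>L\<close> coincides with the speed
    \<open>norm (v x)\<close>, so the integrands of the rotation index and of the bending energy
    already have this shape.\<close>
  have substitution: "((\<lambda>x. L * f (L * x)) has_integral integral {0..L} f) {0..1}"
    if "continuous_on {0..L} f" for f :: "real \<Rightarrow> real"
    using has_integral_substitution[of 0 1 "\<lambda>x. L * x" 0 L f "\<lambda>_. L"] L maps that
    by (auto intro!: derivative_eq_intros)
  have d\<gamma>: "(\<gamma> has_vector_derivative v x) (at x within {0..1})" if x: "x \<in> {0..1}" for x
  proof -
    have "((\<lambda>s. curve_of 0 \<theta> s) has_vector_derivative cis (\<theta> (L * x))) (at (L * x) within {0..L})"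
      unfolding curve_of_def
      by (auto intro!: derivative_eq_intros integral_has_vector_derivative continuous_intros
          c\<theta> in_L x)
    then have "((\<lambda>s. curve_of 0 \<theta> s) has_vector_derivative cis (\<theta> (L * x)))
        (at (L * x) within (\<lambda>x. L * x) ` {0..1})"
      using maps has_vector_derivative_within_subset by blast
    from vector_diff_chain_within[OF dL this] show ?thesis
      by (simp add: \<gamma>_def[abs_def] v_def o_def scaleR_conv_of_real)
  qed
  have dv: "(v has_vector_derivative a x) (at x within {0..1})" if x: "x \<in> {0..1}" for x
  proof -
    have "(\<theta> has_vector_derivative \<kappa> (L * x)) (at (L * x) within (\<lambda>x. L * x) ` {0..1})"
      using d\<theta>[OF in_L[OF x]] maps has_vector_derivative_within_subset
      by (auto simp: has_real_derivative_iff_has_vector_derivative)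
    from vector_diff_chain_within[OF dL this]
    have "((\<lambda>x. \<theta> (L * x)) has_vector_derivative L * \<kappa> (L * x)) (at x within {0..1})"
      by (simp add: o_def)
    then have "((\<lambda>x. cis (\<theta> (L * x))) has_vector_derivative
        (L * \<kappa> (L * x)) *\<^sub>R (\<i> * cis (\<theta> (L * x)))) (at x within {0..1})"
      unfolding has_vector_derivative_def
      by (auto intro!: derivative_eq_intros simp: algebra_simps)
    from has_vector_derivative_mult_right[OF this, of "of_real L"] show ?thesis
      by (simp add: v_def[abs_def] a_def scaleR_conv_of_real power2_eq_square mult_ac)
  qed
  have ca: "continuous_on {0..1} a"
    unfolding a_def
    by (intro continuous_intros continuous_on_compose2[OF c\<kappa> _ maps]
        continuous_on_compose2[OF c\<theta> _ maps])
  have curv: "signed_curvature v a x = \<kappa> (L * x)" for x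
  proof -
    have "cnj (v x) * a x = of_real (L ^ 3 * \<kappa> (L * x)) * (\<i> * (cnj (cis (\<theta> (L * x))) * cis (\<theta> (L * x))))"
      by (simp add: v_def a_def power2_eq_square power3_eq_cube mult_ac)
    also have "cnj (cis (\<theta> (L * x))) * cis (\<theta> (L * x)) = 1"
      by (simp add: cis_cnj cis_mult)
    finally show ?thesis
      using L by (simp add: signed_curvature_def v_def norm_mult)
  qed
  have norm_v: "norm (v x) = L" for x
    using L by (simp add: v_def norm_mult)
  have "closed_W22_immersion \<gamma> v a"
    unfolding closed_W22_immersion_def
  proof (intro conjI ballI)
    show "a absolutely_integrable_on {0..1}"
      using absolutely_integrable_continuous[of 0 1 a] ca by simp
    show "(\<lambda>x. (norm (a x))\<^sup>2) absolutely_integrable_on {0..1}"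
      using absolutely_integrable_continuous[of 0 1 "\<lambda>x. (norm (a x))\<^sup>2"] ca
      by (simp add: continuous_intros)
    fix x :: real assume x: "x \<in> {0..1}"
    have "(a has_integral v x - v 0) {0..x}"
      by (rule fundamental_theorem_of_calculus)
         (use x in \<open>auto intro!: has_vector_derivative_within_subset[OF dv]\<close>)
    then show "v x = v 0 + integral {0..x} a"
      by (simp add: integral_unique)
    show "v x \<noteq> 0"
      using L by (simp add: v_def)
  next
    \<comment> \<open>The angle is not periodic; the tangent closes up because \<open>cis\<close>
      has period 2 pi.\<close>
    have "\<theta> L = \<theta> 0 + 2 * pi"
      using winding by simp
    then show "v 1 = v 0"
      by (simp add: v_def cis_mult[symmetric])
  qed (use d\<gamma> closed in \<open>auto simp: \<gamma>_def\<close>)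
  moreover have "rotation_index v a = 1"
  proof -
    have "(\<kappa> has_integral \<theta> L - \<theta> 0) {0..L}"
      by (rule fundamental_theorem_of_calculus)
         (use d\<theta> L in \<open>auto simp: has_real_derivative_iff_has_vector_derivative\<close>)
    then show ?thesis
      using integral_unique[OF substitution[OF c\<kappa>]] winding
      by (simp add: rotation_index_def curv norm_v integral_unique mult.commute)
  qed
  moreover have "bending_energy v a = integral {0..L} (\<lambda>s. (\<kappa> s)\<^sup>2)"
    using integral_unique[OF substitution[of "\<lambda>s. (\<kappa> s)\<^sup>2"]] c\<kappa>
    by (simp add: bending_energy_def curv norm_v mult.commute continuous_intros)
  moreover have "curve_length v = L"
    by (simp add: curve_length_def norm_v)
  moreover have "\<not> inj_on \<gamma> {0..<1}"
  proof -
    obtain s r where sr: "s \<in> {0..<L}" "r \<in> {0..<L}" "s \<noteq> r" "curve_of 0 \<theta> s = curve_of 0 \<theta> r"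
      using not_inj by (auto simp: inj_on_def)
    then have "\<gamma> (s / L) = \<gamma> (r / L)" "s / L \<in> {0..<1}" "r / L \<in> {0..<1}" "s / L \<noteq> r / L"
      using L by (auto simp: \<gamma>_def)
    then show ?thesis
      by (meson inj_onD)
  qed
  ultimately have "L * integral {0..L} (\<lambda>s. (\<kappa> s)\<^sup>2) \<in> {curve_length v * bending_energy v a | \<gamma> v a.
                closed_W22_immersion \<gamma> v a \<and>
                (rotation_index v a = 1 \<or> rotation_index v a = -1) \<and>
                \<not> inj_on \<gamma> {0..<1}}"
    by (intro CollectI exI[of _ \<gamma>] exI[of _ v] exI[of _ a]) simp
  then show ?thesis
    unfolding C2T_def
  proof (rule cInf_lower)
    show "bdd_below {curve_length v * bending_energy v a | \<gamma> v a.
                closed_W22_immersion \<gamma> v a \<and>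
                (rotation_index v a = 1 \<or> rotation_index v a = -1) \<and>
                \<not> inj_on \<gamma> {0..<1}}"
    proof (rule bdd_belowI)
      \<comment> \<open>A function that is not integrable has integral 0 by convention, so both
        factors are nonnegative for arbitrary \<open>v\<close> and \<open>a\<close> and the infimum
        is over a set bounded below by 0.\<close>
      have "0 \<le> integral S f" if "\<And>x. 0 \<le> f x" for S and f :: "real \<Rightarrow> real"
        using that by (cases "f integrable_on S") (auto simp: not_integrable_integral integral_nonneg)
      then have "0 \<le> curve_length v" "0 \<le> bending_energy v a" for v a
        by (simp_all add: curve_length_def bending_energy_def)
      then show "0 \<le> x" if "x \<in> {curve_length v * bending_energy v a | \<gamma> v a.
                closed_W22_immersion \<gamma> v a \<and>
                (rotation_index v a = 1 \<or> rotation_index v a = -1) \<and>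
                \<not> inj_on \<gamma> {0..<1}}" for x
        using that by auto
    qed
  qed
qed

text \<open>The gradient term of the density is dropped and \<beta> is replaced by its infimum. In
  the expanded square the linear term integrates by the winding condition to
  \<open>2 * c0 * (2 * pi)\<close>, which is the term \<open>4 * pi * c0\<close>.\<close>

lemma energy_ge_bending:
  assumes L: "0 < L" and \<mu>: "0 \<le> \<mu>" and \<beta>: "\<And>x. 0 < \<beta> x" "continuous_on UNIV \<beta>"
    and d\<theta>: "\<And>s. s \<in> {0..L} \<Longrightarrow> (\<theta> has_real_derivative \<kappa> s) (at s within {0..L})"
    and c\<kappa>: "continuous_on {0..L} \<kappa>"
    and c\<rho>: "continuous_on {0..L} \<rho>" "continuous_on {0..L} (ds L \<rho>)"
    and winding: "\<theta> L - \<theta> 0 = 2 * pi"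
  shows "(INF x. \<beta> x) / 2 * (integral {0..L} (\<lambda>s. (\<kappa> s)\<^sup>2) - 4 * pi * c0 + L * c0\<^sup>2)
    \<le> energy L \<mu> c0 \<beta> \<theta> \<rho>"
proof -
  let ?m = "INF x. \<beta> x"
  have m_le: "?m \<le> \<beta> x" for x
    by (rule cINF_lower) (use \<beta>(1) in \<open>auto intro!: bdd_belowI[of _ 0] less_imp_le\<close>)
  have "(\<kappa> has_integral 2 * pi) {0..L}"
    unfolding winding[symmetric]
    by (rule fundamental_theorem_of_calculus)
       (use d\<theta> L in \<open>auto simp: has_real_derivative_iff_has_vector_derivative\<close>)
  moreover have "((\<lambda>s. (\<kappa> s)\<^sup>2) has_integral integral {0..L} (\<lambda>s. (\<kappa> s)\<^sup>2)) {0..L}"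
    by (intro integrable_integral integrable_continuous_interval continuous_intros c\<kappa>)
  moreover have "((\<lambda>s. c0\<^sup>2) has_integral L * c0\<^sup>2) {0..L}"
    using has_integral_const_real[of "c0\<^sup>2" 0 L] L by simp
  ultimately have "((\<lambda>s. (\<kappa> s)\<^sup>2 - 2 * c0 * \<kappa> s + c0\<^sup>2) has_integral
      (integral {0..L} (\<lambda>s. (\<kappa> s)\<^sup>2) - 2 * c0 * (2 * pi) + L * c0\<^sup>2)) {0..L}"
    by (intro has_integral_add has_integral_diff has_integral_mult_right)
  from has_integral_mult_right[OF this, of ?m]
  have lhs: "((\<lambda>s. ?m * (\<kappa> s - c0)\<^sup>2) has_integral
      ?m * (integral {0..L} (\<lambda>s. (\<kappa> s)\<^sup>2) - 4 * pi * c0 + L * c0\<^sup>2)) {0..L}"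
    by (simp add: power2_diff algebra_simps)
  have rhs: "((\<lambda>s. \<beta> (\<rho> s) * (ds L \<theta> s - c0)\<^sup>2 + \<mu> * (ds L \<rho> s)\<^sup>2) has_integral
      2 * energy L \<mu> c0 \<beta> \<theta> \<rho>) {0..L}"
  proof -
    have "continuous_on {0..L} (ds L \<theta>)"
      using c\<kappa> by (rule continuous_on_eq) (use ds_eqI[OF L _ d\<theta>] in auto)
    then have "(\<lambda>s. \<beta> (\<rho> s) * (ds L \<theta> s - c0)\<^sup>2 + \<mu> * (ds L \<rho> s)\<^sup>2) integrable_on {0..L}"
      by (intro integrable_continuous_interval continuous_intros c\<rho>
          continuous_on_compose2[OF \<beta>(2) c\<rho>(1)]) auto
    then show ?thesis
      by (simp add: energy_def integrable_integral)
  qed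
  have "?m * (integral {0..L} (\<lambda>s. (\<kappa> s)\<^sup>2) - 4 * pi * c0 + L * c0\<^sup>2) \<le> 2 * energy L \<mu> c0 \<beta> \<theta> \<rho>"
  proof (rule has_integral_le[OF lhs rhs])
    fix s assume "s \<in> {0..L}"
    then have "ds L \<theta> s = \<kappa> s"
      using ds_eqI[OF L _ d\<theta>] by blast
    then show "?m * (\<kappa> s - c0)\<^sup>2 \<le> \<beta> (\<rho> s) * (ds L \<theta> s - c0)\<^sup>2 + \<mu> * (ds L \<rho> s)\<^sup>2"
      using m_le \<mu> by (auto intro!: add_increasing2 mult_right_mono)
  qed
  then show ?thesis
    by simp
qed

section \<open>The multipliers\<close>

text \<open>\<open>Pi_matrix\<close> is the Gram matrix of sin \<theta> and - cos \<theta> on the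
  interval. If it were singular, these two functions would be linearly dependent, and a fixed linear
  relation between them freezes the angle, against \<open>ne\<close>.\<close>

lemma Pi_matrix_invertible:
  assumes L: "0 < L"
    and d\<theta>: "\<And>s. s \<in> {0..L} \<Longrightarrow> (\<theta> has_real_derivative \<kappa> s) (at s within {0..L})"
    and ne: "\<theta> L \<noteq> \<theta> 0"
  shows "invertible (Pi_matrix L \<theta>)"
proof (rule ccontr)
  assume singular: "\<not> invertible (Pi_matrix L \<theta>)"
  define A B C where "A = integral {0..L} (\<lambda>s. (sin (\<theta> s))\<^sup>2)"
    and "B = integral {0..L} (\<lambda>s. cos (\<theta> s) * sin (\<theta> s))"
    and "C = integral {0..L} (\<lambda>s. (cos (\<theta> s))\<^sup>2)"
  have c\<theta>: "continuous_on {0..L} \<theta>"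
    using DERIV_continuous_on[of "{0..L}" \<theta> \<kappa>] d\<theta> by auto
  have iA: "((\<lambda>s. (sin (\<theta> s))\<^sup>2) has_integral A) {0..L}"
    and iB: "((\<lambda>s. cos (\<theta> s) * sin (\<theta> s)) has_integral B) {0..L}"
    and iC: "((\<lambda>s. (cos (\<theta> s))\<^sup>2) has_integral C) {0..L}"
    unfolding A_def B_def C_def
    by (intro integrable_integral integrable_continuous_interval continuous_intros c\<theta>)+
  have "((\<lambda>s. (sin (\<theta> s))\<^sup>2 + (cos (\<theta> s))\<^sup>2) has_integral A + C) {0..L}"
    by (intro has_integral_add iA iC)
  then have AC: "A + C = L"
    using has_integral_unique[OF _ has_integral_const_real[of "1::real" 0 L]] L by simp
  have det: "A * C = B * B"
    using singular unfolding invertible_det_nz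
    by (simp add: det_2 Pi_matrix_def A_def B_def C_def)
  have quadratic: "integral {0..L} (\<lambda>s. (x * sin (\<theta> s) - y * cos (\<theta> s))\<^sup>2) =
      x\<^sup>2 * A - 2 * x * y * B + y\<^sup>2 * C" for x y
  proof -
    have "((\<lambda>s. x\<^sup>2 * (sin (\<theta> s))\<^sup>2 - 2 * x * y * (cos (\<theta> s) * sin (\<theta> s)) + y\<^sup>2 * (cos (\<theta> s))\<^sup>2)
        has_integral (x\<^sup>2 * A - 2 * x * y * B + y\<^sup>2 * C)) {0..L}"
      by (intro has_integral_add has_integral_diff has_integral_mult_right iA iB iC)
    then show ?thesis
      by (intro integral_unique) (simp add: power2_eq_square algebra_simps)
  qed
  \<comment> \<open>A kernel vector of a singular symmetric matrix is read off from its cofactors: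
    \<open>(C, B)\<close> if \<open>C\<close> is nonzero, and otherwise \<open>(B, A)\<close>, where
    \<open>A = L\<close> is nonzero by \<open>AC\<close>.\<close>
  obtain x y where xy: "x\<^sup>2 * A - 2 * x * y * B + y\<^sup>2 * C = 0" "x \<noteq> 0 \<or> y \<noteq> 0"
  proof (cases "C = 0")
    case False
    moreover have "C\<^sup>2 * A - 2 * C * B * B + B\<^sup>2 * C = C * (A * C - B * B)"
      by (simp add: power2_eq_square algebra_simps)
    ultimately show ?thesis
      using that[of C B] det by simp
  next
    case True
    then have "A \<noteq> 0"
      using AC L by simp
    moreover have "B\<^sup>2 * A - 2 * B * A * B + A\<^sup>2 * C = A * (A * C - B * B)"
      by (simp add: power2_eq_square algebra_simps)
    ultimately show ?thesis
      using that[of B A] det by simp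
  qed
  have "\<forall>s\<in>{0..L}. (x * sin (\<theta> s) - y * cos (\<theta> s))\<^sup>2 = 0"
    using integral_eq_0_iff[of 0 L "\<lambda>s. (x * sin (\<theta> s) - y * cos (\<theta> s))\<^sup>2"] L quadratic[of x y] xy
    by (simp add: continuous_intros c\<theta>)
  then have dep: "x * sin (\<theta> s) - y * cos (\<theta> s) = 0" if "s \<in> {0..L}" for s
    using that by simp
  have "\<kappa> s = 0" if s: "s \<in> {0..L}" for s
  proof -
    \<comment> \<open>Differentiating the linear relation gives \<kappa> times the complementary
      combination, which is shown below to be nonzero.\<close>
    have "((\<lambda>s. x * sin (\<theta> s) - y * cos (\<theta> s)) has_real_derivative
        \<kappa> s * (x * cos (\<theta> s) + y * sin (\<theta> s))) (at s within {0..L})"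
      by (auto intro!: derivative_eq_intros d\<theta> s simp: algebra_simps)
    then have "\<kappa> s * (x * cos (\<theta> s) + y * sin (\<theta> s)) =
        ds L (\<lambda>s. x * sin (\<theta> s) - y * cos (\<theta> s)) s"
      using ds_eqI[OF L s] by simp
    also have "\<dots> = ds L (\<lambda>s. 0) s"
      using dep by (intro ds_cong s) auto
    also have "\<dots> = 0"
      by (rule ds_eqI[OF L s]) simp
    finally have "\<kappa> s * (x * cos (\<theta> s) + y * sin (\<theta> s)) = 0" .
    \<comment> \<open>Up to sign, the two combinations are the coordinates of \<open>(x, y)\<close>
      in a rotated frame, so their squares sum to its squared norm. The second vanishes, hence the
      first does not.\<close>
    moreover have "(x * cos (\<theta> s) + y * sin (\<theta> s))\<^sup>2 + (x * sin (\<theta> s) - y * cos (\<theta> s))\<^sup>2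
        = (x\<^sup>2 + y\<^sup>2) * ((sin (\<theta> s))\<^sup>2 + (cos (\<theta> s))\<^sup>2)"
      by algebra
    then have "(x * cos (\<theta> s) + y * sin (\<theta> s))\<^sup>2 = x\<^sup>2 + y\<^sup>2"
      using dep[OF s] by simp
    then have "x * cos (\<theta> s) + y * sin (\<theta> s) \<noteq> 0"
      using xy(2) by (auto simp: sum_power2_eq_zero_iff)
    ultimately show ?thesis
      by simp
  qed
  moreover have "(\<kappa> has_integral \<theta> L - \<theta> 0) {0..L}"
    by (rule fundamental_theorem_of_calculus)
       (use d\<theta> L in \<open>auto simp: has_real_derivative_iff_has_vector_derivative\<close>)
  ultimately have "\<theta> L - \<theta> 0 = 0"
    using has_integral_eq[of "{0..L}" \<kappa> "\<lambda>_. 0"] has_integral_unique has_integral_0 by metis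
  then show False
    using ne by simp
qed

text \<open>Multiplying the definition of the multipliers by \<open>Pi_matrix\<close> gives a linear
  system whose right-hand sides are the integrals that arise when the flux term is integrated by
  parts against sin \<theta> and cos \<theta>.\<close>

lemma lambda_theta_system:
  fixes L c0 :: real and \<beta> \<theta> \<rho> \<kappa> :: "real \<Rightarrow> real"
  assumes L: "0 < L"
    and d\<theta>: "\<And>s. s \<in> {0..L} \<Longrightarrow> (\<theta> has_real_derivative \<kappa> s) (at s within {0..L})"
    and c\<kappa>: "continuous_on {0..L} \<kappa>" and c\<beta>: "continuous_on {0..L} (\<lambda>s. \<beta> (\<rho> s))"
    and ne: "\<theta> L \<noteq> \<theta> 0"
  defines "l \<equiv> lambda_theta L c0 \<beta> \<theta> \<rho>"
  shows "l $ 1 * integral {0..L} (\<lambda>s. (sin (\<theta> s))\<^sup>2)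
         - l $ 2 * integral {0..L} (\<lambda>s. cos (\<theta> s) * sin (\<theta> s))
         = integral {0..L} (\<lambda>s. \<beta> (\<rho> s) * (\<kappa> s - c0) * (cos (\<theta> s) * \<kappa> s))"
    and "l $ 2 * integral {0..L} (\<lambda>s. (cos (\<theta> s))\<^sup>2)
         - l $ 1 * integral {0..L} (\<lambda>s. cos (\<theta> s) * sin (\<theta> s))
         = integral {0..L} (\<lambda>s. \<beta> (\<rho> s) * (\<kappa> s - c0) * (sin (\<theta> s) * \<kappa> s))"
proof -
  let ?M = "Pi_matrix L \<theta>"
  let ?g = "\<lambda>s. (ds L \<theta> s * \<beta> (\<rho> s) * (ds L \<theta> s - c0)) *\<^sub>R (vector [cos (\<theta> s), sin (\<theta> s)] :: real^2)"
  let ?h = "\<lambda>s. (\<kappa> s * \<beta> (\<rho> s) * (\<kappa> s - c0)) *\<^sub>R (vector [cos (\<theta> s), sin (\<theta> s)] :: real^2)"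
  have c\<theta>: "continuous_on {0..L} \<theta>"
    using DERIV_continuous_on[of "{0..L}" \<theta> \<kappa>] d\<theta> by auto
  have "integral {0..L} ?g = integral {0..L} ?h"
    using ds_eqI[OF L _ d\<theta>] by (intro integral_cong) auto
  \<comment> \<open>\<open>matrix_inv\<close> is a Hilbert choice; invertibility is what makes it an
    actual inverse.\<close>
  moreover have "?M ** matrix_inv ?M = mat 1"
    using Pi_matrix_invertible[OF L d\<theta> ne] unfolding invertible_def matrix_inv_def
    by (metis (mono_tags, lifting) someI_ex)
  then have "?M *v l = integral {0..L} ?g"
    by (simp add: l_def lambda_theta_def matrix_vector_mul_assoc)
  ultimately have eq: "?M *v l = integral {0..L} ?h"
    by simp
  have vec: "vector [cos (\<theta> s), sin (\<theta> s)] = (\<chi> i. if i = (1::2) then cos (\<theta> s) else sin (\<theta> s))" for s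
    by (simp add: vec_eq_iff forall_2)
  have "continuous_on {0..L} (\<lambda>s. vector [cos (\<theta> s), sin (\<theta> s)] :: real^2)"
    unfolding vec
  proof (rule continuous_on_vec_lambda)
    show "continuous_on {0..L} (\<lambda>s. if i = (1::2) then cos (\<theta> s) else sin (\<theta> s))" for i
      by (cases "i = 1") (simp_all add: continuous_intros c\<theta>)
  qed
  then have "?h integrable_on {0..L}"
    by (intro integrable_continuous_interval continuous_intros c\<kappa> c\<beta>)
  from this[THEN integral_component_eq_cart]
  have comp: "integral {0..L} ?h $ i = integral {0..L} (\<lambda>s. ?h s $ i)" for i
    by simp
  show "l $ 1 * integral {0..L} (\<lambda>s. (sin (\<theta> s))\<^sup>2)
         - l $ 2 * integral {0..L} (\<lambda>s. cos (\<theta> s) * sin (\<theta> s))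
         = integral {0..L} (\<lambda>s. \<beta> (\<rho> s) * (\<kappa> s - c0) * (cos (\<theta> s) * \<kappa> s))"
    using arg_cong[OF eq, of "\<lambda>v. v $ 1"] unfolding comp
    by (simp add: matrix_vector_mult_def sum_2 Pi_matrix_def mult_ac)
  show "l $ 2 * integral {0..L} (\<lambda>s. (cos (\<theta> s))\<^sup>2)
         - l $ 1 * integral {0..L} (\<lambda>s. cos (\<theta> s) * sin (\<theta> s))
         = integral {0..L} (\<lambda>s. \<beta> (\<rho> s) * (\<kappa> s - c0) * (sin (\<theta> s) * \<kappa> s))"
    using arg_cong[OF eq, of "\<lambda>v. v $ 2"] unfolding comp
    by (simp add: matrix_vector_mult_def sum_2 Pi_matrix_def mult_ac)
qed

section \<open>Regularity in space-time\<close>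

text \<open>An argument with two halves of \<open>e\<close>: first move in time, uniformly in space,
  to the slice at \<open>fst x\<close>, then move in space along this one slice.\<close>

lemma continuous_on_Times_uniform_limit:
  fixes g :: "'a::metric_space \<Rightarrow> 'b::metric_space \<Rightarrow> 'c::metric_space"
  assumes cont: "\<And>t. t \<in> T \<Longrightarrow> continuous_on S (g t)"
    and lim: "\<And>t. t \<in> T \<Longrightarrow> uniform_limit S g (g t) (at t within T)"
  shows "continuous_on (T \<times> S) (\<lambda>x. g (fst x) (snd x))"
  unfolding continuous_on_iff
proof (intro ballI allI impI)
  fix x and e :: real assume x: "x \<in> T \<times> S" and "0 < e"
  then have "0 < e / 2" "fst x \<in> T" "snd x \<in> S"
    by auto
  obtain d1 where "0 < d1"
    and d1: "\<And>t s. t \<in> T \<Longrightarrow> dist t (fst x) < d1 \<Longrightarrow> s \<in> S \<Longrightarrow> dist (g t s) (g (fst x) s) < e / 2"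
  proof -
    have "\<forall>\<^sub>F t in at (fst x) within T. \<forall>s\<in>S. dist (g t s) (g (fst x) s) < e / 2"
      using lim[OF \<open>fst x \<in> T\<close>] \<open>0 < e / 2\<close> by (rule uniform_limitD)
    then obtain d where "0 < d" and
      d: "\<And>t. t \<in> T \<Longrightarrow> t \<noteq> fst x \<Longrightarrow> dist t (fst x) < d \<Longrightarrow> \<forall>s\<in>S. dist (g t s) (g (fst x) s) < e / 2"
      unfolding eventually_at by blast
    \<comment> \<open>The filter leaves out the time \<open>fst x\<close> itself, where the distance
      is 0.\<close>
    then show ?thesis
      using that[of d] \<open>0 < e / 2\<close> by (metis dist_self)
  qed
  obtain d2 where "0 < d2"
    and d2: "\<And>s. s \<in> S \<Longrightarrow> dist s (snd x) < d2 \<Longrightarrow> dist (g (fst x) s) (g (fst x) (snd x)) < e / 2"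
    using cont[OF \<open>fst x \<in> T\<close>] \<open>snd x \<in> S\<close> \<open>0 < e / 2\<close> unfolding continuous_on_iff by metis
  show "\<exists>d>0. \<forall>x'\<in>T \<times> S. dist x' x < d \<longrightarrow> dist (g (fst x') (snd x')) (g (fst x) (snd x)) < e"
  proof (intro exI[of _ "min d1 d2"] conjI ballI impI)
    fix x' assume x': "x' \<in> T \<times> S" "dist x' x < min d1 d2"
    then have "dist (fst x') (fst x) < d1" "dist (snd x') (snd x) < d2"
      using dist_fst_le[of x' x] dist_snd_le[of x' x] by linarith+
    then have "dist (g (fst x') (snd x')) (g (fst x) (snd x')) < e / 2"
      "dist (g (fst x) (snd x')) (g (fst x) (snd x)) < e / 2"
      using x' d1 d2 by auto
    then show "dist (g (fst x') (snd x')) (g (fst x) (snd x)) < e"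
      using dist_triangle[of "g (fst x') (snd x')" "g (fst x) (snd x)" "g (fst x) (snd x')"] by linarith
  qed (use \<open>0 < d1\<close> \<open>0 < d2\<close> in auto)
qed

text \<open>This provides joint continuity up to time 0, where \<open>smooth_spacetime\<close> says
  nothing. The orders 0 and 1 are those occurring in the energy.\<close>

lemma C0_C2_continuous_on:
  assumes "C0_C2 L f" "j < 2"
  shows "continuous_on ({0..} \<times> {0..L}) (\<lambda>x. (ds L ^^ j) (f (fst x)) (snd x))"
proof (rule continuous_on_Times_uniform_limit)
  fix t :: real assume "t \<in> {0..}"
  then show "continuous_on {0..L} ((ds L ^^ j) (f t))"
    using assms unfolding C0_C2_def C2_interval_def
    by (intro differentiable_imp_continuous_on) (auto simp: differentiable_on_def)
  show "uniform_limit {0..L} (\<lambda>\<tau>. (ds L ^^ j) (f \<tau>)) ((ds L ^^ j) (f t)) (at t within {0..})"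
    using assms \<open>t \<in> {0..}\<close> unfolding C0_C2_def by auto
qed

text \<open>The body of the existential in \<open>smooth_spacetime\<close>, named so that one family
  of derivatives can be fixed for the whole argument.\<close>

definition spacetime_derivatives ::
  "real \<Rightarrow> (real \<Rightarrow> real \<Rightarrow> real) \<Rightarrow> (nat \<Rightarrow> nat \<Rightarrow> real \<Rightarrow> real \<Rightarrow> real) \<Rightarrow> bool" where
  "spacetime_derivatives L f D \<longleftrightarrow>
        (\<forall>t>0. \<forall>s\<in>{0..L}. D 0 0 t s = f t s) \<and>
        (\<forall>j k. continuous_on ({0<..} \<times> {0..L}) (\<lambda>(t, s). D j k t s)) \<and>
        (\<forall>j k. \<forall>t>0. \<forall>s\<in>{0..L}.
           ((\<lambda>\<tau>. D j k \<tau> s) has_real_derivative D (Suc j) k t s) (at t) \<and>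
           ((\<lambda>\<sigma>. D j k t \<sigma>) has_real_derivative D j (Suc k) t s) (at s within {0..L}))"

lemma smooth_spacetime_iff:
  "smooth_spacetime L f \<longleftrightarrow> (\<exists>D. spacetime_derivatives L f D)"
  by (simp add: smooth_spacetime_def spacetime_derivatives_def)

context
  fixes L :: real and f D
  assumes D: "spacetime_derivatives L f D"
begin

lemma spacetime_derivatives_00: "0 < t \<Longrightarrow> s \<in> {0..L} \<Longrightarrow> D 0 0 t s = f t s"
  using D by (simp add: spacetime_derivatives_def)

lemma spacetime_derivatives_t:
  "0 < t \<Longrightarrow> s \<in> {0..L} \<Longrightarrow> ((\<lambda>\<tau>. D j k \<tau> s) has_real_derivative D (j + 1) k t s) (at t)"
  using D by (simp add: spacetime_derivatives_def)

lemma spacetime_derivatives_s: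
  "0 < t \<Longrightarrow> s \<in> {0..L} \<Longrightarrow> (D j k t has_real_derivative D j (k + 1) t s) (at s within {0..L})"
  using D by (simp add: spacetime_derivatives_def)

text \<open>Composition with general \<open>g\<close> and \<open>h\<close> covers both the slices at
  a fixed time and the whole space-time domain with a single introduction rule.\<close>

lemma spacetime_derivatives_continuous:
  assumes "continuous_on S g" "continuous_on S h" "\<And>x. x \<in> S \<Longrightarrow> 0 < g x \<and> h x \<in> {0..L}"
  shows "continuous_on S (\<lambda>x. D j k (g x) (h x))"
proof -
  have "continuous_on ({0<..} \<times> {0..L}) (\<lambda>(t, s). D j k t s)"
    using D by (simp add: spacetime_derivatives_def)
  from continuous_on_compose2[OF this continuous_on_Pair[OF assms(1,2)]] show ?thesis
    using assms(3) by (fastforce simp: image_subset_iff)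
qed

lemma spacetime_derivatives_deriv:
  assumes "0 < t" "s \<in> {0..L}"
  shows "((\<lambda>\<tau>. f \<tau> s) has_real_derivative D 1 0 t s) (at t)"
proof (rule has_field_derivative_transform_within_open[of "\<lambda>\<tau>. D 0 0 \<tau> s" _ _ "{0<..}"])
  show "((\<lambda>\<tau>. D 0 0 \<tau> s) has_real_derivative D 1 0 t s) (at t)"
    using spacetime_derivatives_t[OF assms] by simp
qed (use assms spacetime_derivatives_00 in auto)

lemma spacetime_derivatives_ds:
  assumes "0 < t" "s \<in> {0..L}" "0 < L"
  shows "ds L (f t) s = D 0 1 t s"
proof -
  have "ds L (f t) s = ds L (D 0 0 t) s"
    using assms spacetime_derivatives_00 by (intro ds_cong) auto
  also have "\<dots> = D 0 1 t s"
    using spacetime_derivatives_s[OF assms(1,2), of 0 0] by (intro ds_eqI) (use assms in auto)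
  finally show ?thesis .
qed

lemma spacetime_derivatives_ds2:
  assumes "0 < t" "s \<in> {0..L}" "0 < L"
  shows "(ds L ^^ 2) (f t) s = D 0 2 t s"
proof -
  have "(ds L ^^ 2) (f t) s = ds L (ds L (f t)) s"
    by (simp add: numeral_2_eq_2)
  also have "\<dots> = ds L (D 0 1 t) s"
    using assms spacetime_derivatives_ds by (intro ds_cong) auto
  also have "\<dots> = D 0 2 t s"
    using spacetime_derivatives_s[OF assms(1,2), of 0 1]
    by (intro ds_eqI) (use assms in \<open>auto simp: numeral_2_eq_2\<close>)
  finally show ?thesis .
qed

end

lemma DERIV_cong_pos:
  fixes f g :: "real \<Rightarrow> real"
  assumes "(f has_real_derivative d) (at t)" "0 < t" "\<And>\<tau>. 0 < \<tau> \<Longrightarrow> f \<tau> = g \<tau>"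
  shows "(g has_real_derivative d) (at t)"
  by (rule has_field_derivative_transform_within_open[OF assms(1), of "{0<..}"]) (use assms in auto)

section \<open>The flow\<close>

text \<open>The families \<open>\<Theta>\<close> and \<open>R\<close> are parameters, so that the
  equations can be handled with genuine partial derivatives instead of \<open>deriv\<close> and
  \<open>ds\<close>. A nonzero \<omega> keeps the angle from being constant and thus makes
  \<open>Pi_matrix\<close> invertible.\<close>

locale elastic_flow =
  fixes L \<mu> c0 :: real and \<omega> :: int
    and \<beta> \<theta>0 \<rho>0 :: "real \<Rightarrow> real"
    and \<theta> \<rho> :: "real \<Rightarrow> real \<Rightarrow> real"
    and \<Theta> R :: "nat \<Rightarrow> nat \<Rightarrow> real \<Rightarrow> real \<Rightarrow> real"
  assumes L: "0 < L"
    and smooth_\<beta>: "smooth_real \<beta>"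
    and solution: "global_solution L \<mu> \<omega> c0 \<beta> \<theta>0 \<rho>0 \<theta> \<rho>"
    and \<omega>: "\<omega> \<noteq> 0"
    and \<Theta>: "spacetime_derivatives L \<theta> \<Theta>"
    and R: "spacetime_derivatives L \<rho> R"
begin

declare One_nat_def [simp del]

lemma \<beta>_deriv: "(\<beta> has_real_derivative deriv \<beta> x) (at x)"
proof -
  have "((deriv ^^ 0) \<beta>) differentiable (at x)"
    using smooth_\<beta> unfolding smooth_real_def by blast
  then show ?thesis
    by (simp add: DERIV_deriv_iff_real_differentiable)
qed

lemma \<beta>_continuous: "continuous_on UNIV \<beta>"
  using DERIV_continuous_on[of UNIV \<beta> "deriv \<beta>"] \<beta>_deriv by blast

lemma \<beta>'_continuous: "continuous_on UNIV (deriv \<beta>)"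
proof -
  have "((deriv ^^ 1) \<beta>) differentiable (at x)" for x
    using smooth_\<beta> unfolding smooth_real_def by blast
  then show ?thesis
    by (intro differentiable_imp_continuous_on) (simp add: differentiable_on_def One_nat_def)
qed

lemmas \<Theta>_00 = spacetime_derivatives_00[OF \<Theta>]
  and R_00 = spacetime_derivatives_00[OF R]
  and \<Theta>_t = spacetime_derivatives_t[OF \<Theta>]
  and R_t = spacetime_derivatives_t[OF R]
  and \<Theta>_s = spacetime_derivatives_s[OF \<Theta>]
  and R_s = spacetime_derivatives_s[OF R]

lemmas flow_continuous_intros = continuous_intros
  spacetime_derivatives_continuous[OF \<Theta>] spacetime_derivatives_continuous[OF R]
  continuous_on_compose2[OF \<beta>_continuous _ subset_UNIV]
  continuous_on_compose2[OF \<beta>'_continuous _ subset_UNIV]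

text \<open>The bending moment: the derivative of the energy density with respect to the
  curvature.\<close>

definition flux :: "real \<Rightarrow> real \<Rightarrow> real" where
  "flux t s = \<beta> (R 0 0 t s) * (\<Theta> 0 1 t s - c0)"

definition flux_s :: "real \<Rightarrow> real \<Rightarrow> real" where
  "flux_s t s = deriv \<beta> (R 0 0 t s) * R 0 1 t s * (\<Theta> 0 1 t s - c0) + \<beta> (R 0 0 t s) * \<Theta> 0 2 t s"

abbreviation l1 :: "real \<Rightarrow> real" where "l1 t \<equiv> lambda_theta L c0 \<beta> (\<theta> t) (\<rho> t) $ 1"
abbreviation l2 :: "real \<Rightarrow> real" where "l2 t \<equiv> lambda_theta L c0 \<beta> (\<theta> t) (\<rho> t) $ 2"
abbreviation lr :: "real \<Rightarrow> real" where "lr t \<equiv> lambda_rho L c0 \<beta> (\<theta> t) (\<rho> t)"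

lemma flux_deriv:
  assumes "0 < t" "s \<in> {0..L}"
  shows "(flux t has_real_derivative flux_s t s) (at s within {0..L})"
proof -
  have "((\<lambda>s. \<beta> (R 0 0 t s)) has_real_derivative deriv \<beta> (R 0 0 t s) * R 0 1 t s) (at s within {0..L})"
    using DERIV_chain2[OF \<beta>_deriv R_s[OF assms, of 0 0]] by simp
  moreover have "((\<lambda>s. \<Theta> 0 1 t s - c0) has_real_derivative \<Theta> 0 2 t s) (at s within {0..L})"
    using \<Theta>_s[OF assms, of 0 1] by (auto intro!: derivative_eq_intros)
  ultimately show ?thesis
    using DERIV_mult unfolding flux_def[abs_def] flux_s_def by (fastforce simp: algebra_simps)
qed

lemma \<theta>_equation:
  assumes "0 < t" "s \<in> {0..L}"
  shows "\<Theta> 1 0 t s = flux_s t s + l1 t * sin (\<Theta> 0 0 t s) - l2 t * cos (\<Theta> 0 0 t s)"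
proof -
  have "\<Theta> 1 0 t s = deriv (\<lambda>\<tau>. \<theta> \<tau> s) t"
    using spacetime_derivatives_deriv[OF \<Theta> assms] by (simp add: DERIV_imp_deriv)
  also have "\<dots> = ds L (\<lambda>\<sigma>. \<beta> (\<rho> t \<sigma>) * (ds L (\<theta> t) \<sigma> - c0)) s
          + l1 t * sin (\<theta> t s) - l2 t * cos (\<theta> t s)"
    using solution assms unfolding global_solution_def by blast
  also have "ds L (\<lambda>\<sigma>. \<beta> (\<rho> t \<sigma>) * (ds L (\<theta> t) \<sigma> - c0)) s = ds L (flux t) s"
    using assms L
    by (intro ds_cong) (auto simp: flux_def R_00 spacetime_derivatives_ds[OF \<Theta>])
  also have "\<dots> = flux_s t s"
    by (intro ds_eqI L assms flux_deriv)
  finally show ?thesis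
    using assms by (simp add: \<Theta>_00)
qed

lemma \<rho>_equation:
  assumes "0 < t" "s \<in> {0..L}"
  shows "R 1 0 t s = \<mu> * R 0 2 t s - 1 / 2 * deriv \<beta> (R 0 0 t s) * (\<Theta> 0 1 t s - c0)\<^sup>2 - lr t"
proof -
  have "R 1 0 t s = deriv (\<lambda>\<tau>. \<rho> \<tau> s) t"
    using spacetime_derivatives_deriv[OF R assms] by (simp add: DERIV_imp_deriv)
  also have "\<dots> = \<mu> * (ds L ^^ 2) (\<rho> t) s
          - 1 / 2 * deriv \<beta> (\<rho> t s) * (ds L (\<theta> t) s - c0)\<^sup>2 - lr t"
    using solution assms unfolding global_solution_def by blast
  finally show ?thesis
    using assms L
    by (simp add: R_00 spacetime_derivatives_ds[OF \<Theta>] spacetime_derivatives_ds2[OF R])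
qed

lemma boundary:
  assumes "0 < t"
  shows "\<Theta> 0 0 t L = \<Theta> 0 0 t 0 + 2 * pi * of_int \<omega>" "R 0 0 t L = R 0 0 t 0"
    "\<Theta> 0 1 t L = \<Theta> 0 1 t 0" "R 0 1 t L = R 0 1 t 0"
proof -
  have *: "\<theta> t L - \<theta> t 0 = 2 * pi * of_int \<omega> \<and> \<rho> t L = \<rho> t 0 \<and>
            ds L (\<theta> t) L = ds L (\<theta> t) 0 \<and> ds L (\<rho> t) L = ds L (\<rho> t) 0"
    using solution assms unfolding global_solution_def by blast
  have "0 \<in> {0..L}" "L \<in> {0..L}"
    using L by auto
  with * show "\<Theta> 0 0 t L = \<Theta> 0 0 t 0 + 2 * pi * of_int \<omega>" "R 0 0 t L = R 0 0 t 0"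
    "\<Theta> 0 1 t L = \<Theta> 0 1 t 0" "R 0 1 t L = R 0 1 t 0"
    by (simp_all add: \<Theta>_00 R_00 assms L spacetime_derivatives_ds[OF \<Theta> assms]
        spacetime_derivatives_ds[OF R assms])
qed

text \<open>The boundary conditions are differentiated in time; the jump of the angle is the same at
  all positive times and drops out.\<close>

lemma boundary_t:
  assumes "0 < t"
  shows "\<Theta> 1 0 t L = \<Theta> 1 0 t 0" "R 1 0 t L = R 1 0 t 0"
proof -
  have "0 \<in> {0..L}" "L \<in> {0..L}"
    using L by auto
  note d = this[THEN \<Theta>_t[OF assms, of _ 0 0]] this[THEN R_t[OF assms, of _ 0 0]]
  have "((\<lambda>\<tau>. \<Theta> 0 0 \<tau> L) has_real_derivative \<Theta> 1 0 t 0) (at t)"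
    by (rule has_field_derivative_transform_within_open[of "\<lambda>\<tau>. \<Theta> 0 0 \<tau> 0 + 2 * pi * of_int \<omega>" _ _ "{0<..}"])
       (use d assms boundary in \<open>auto intro!: derivative_eq_intros\<close>)
  then show "\<Theta> 1 0 t L = \<Theta> 1 0 t 0"
    using d by (auto intro: DERIV_unique)
  have "((\<lambda>\<tau>. R 0 0 \<tau> L) has_real_derivative R 1 0 t 0) (at t)"
    by (rule has_field_derivative_transform_within_open[of "\<lambda>\<tau>. R 0 0 \<tau> 0" _ _ "{0<..}"])
       (use d assms boundary in auto)
  then show "R 1 0 t L = R 1 0 t 0"
    using d by (auto intro: DERIV_unique)
qed

lemma sin_cos_boundary:
  assumes "0 < t"
  shows "sin (\<Theta> 0 0 t L) = sin (\<Theta> 0 0 t 0)" "cos (\<Theta> 0 0 t L) = cos (\<Theta> 0 0 t 0)"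
  unfolding boundary(1)[OF assms] sin_add cos_add
  by (simp_all only: cos_int_2pin sin_int_2pin mult_1_right mult_zero_right add_0_right diff_zero)

lemma flux_boundary: "0 < t \<Longrightarrow> flux t L = flux t 0"
  by (simp add: flux_def boundary)

lemma continuous_flux:
  assumes "0 < t"
  shows "continuous_on {0..L} (flux t)" "continuous_on {0..L} (flux_s t)"
  unfolding flux_def[abs_def] flux_s_def[abs_def]
  by (intro flow_continuous_intros; use assms in simp)+

section \<open>Orthogonality relations enforced by the multipliers\<close>

text \<open>These integrals are, up to sign, the velocities of the two closing integrals. Test the
  angle equation with sin \<theta> or cos \<theta>: integrating the flux term by parts yields one
  side of the linear system for the multipliers, the multiplier terms yield the other, and the two
  cancel.\<close>

lemma \<theta>_t_orthogonal:
  assumes t: "0 < t"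
  shows "integral {0..L} (\<lambda>s. sin (\<Theta> 0 0 t s) * \<Theta> 1 0 t s) = 0"
    and "integral {0..L} (\<lambda>s. cos (\<Theta> 0 0 t s) * \<Theta> 1 0 t s) = 0"
proof -
  let ?A = "integral {0..L} (\<lambda>s. (sin (\<Theta> 0 0 t s))\<^sup>2)"
    and ?B = "integral {0..L} (\<lambda>s. cos (\<Theta> 0 0 t s) * sin (\<Theta> 0 0 t s))"
    and ?C = "integral {0..L} (\<lambda>s. (cos (\<Theta> 0 0 t s))\<^sup>2)"
  have c: "continuous_on {0..L} (\<Theta> j k t)" "continuous_on {0..L} (R j k t)" for j k
    by (intro flow_continuous_intros; use t in simp)+
  have d: "(\<Theta> 0 0 t has_real_derivative \<Theta> 0 1 t s) (at s within {0..L})" if "s \<in> {0..L}" for s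
    using \<Theta>_s[OF t that, of 0 0] by simp
  \<comment> \<open>The multipliers see the functions only on \<open>{0..L}\<close>, which is where
    \<open>\<theta>\<close> and \<open>\<Theta> 0 0\<close> are known to agree.\<close>
  have "lambda_theta L c0 \<beta> (\<theta> t) (\<rho> t) = lambda_theta L c0 \<beta> (\<Theta> 0 0 t) (R 0 0 t)"
  proof -
    have eq: "\<theta> t s = \<Theta> 0 0 t s" "\<rho> t s = R 0 0 t s" "ds L (\<theta> t) s = ds L (\<Theta> 0 0 t) s"
      if "s \<in> {0..L}" for s
      using that \<Theta>_00 R_00 t by (auto intro!: ds_cong)
    show ?thesis
      unfolding lambda_theta_def Pi_matrix_def
      by (intro arg_cong2[of _ _ _ _ "(*v)"] arg_cong[of _ _ matrix_inv] arg_cong2[of _ _ _ _ "\<lambda>u v. vector [u, v]"]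
          arg_cong[of _ _ uminus] integral_cong) (simp_all add: eq)
  qed
  moreover have "\<Theta> 0 0 t L \<noteq> \<Theta> 0 0 t 0"
    using boundary(1)[OF t] \<omega> by simp
  moreover have "continuous_on {0..L} (\<lambda>s. \<beta> (R 0 0 t s))"
    by (intro flow_continuous_intros c)
  ultimately have
    system: "l1 t * ?A - l2 t * ?B = integral {0..L} (\<lambda>s. flux t s * (cos (\<Theta> 0 0 t s) * \<Theta> 0 1 t s))"
      "l2 t * ?C - l1 t * ?B = integral {0..L} (\<lambda>s. flux t s * (sin (\<Theta> 0 0 t s) * \<Theta> 0 1 t s))"
    using lambda_theta_system[OF L d c(1), of \<beta> "R 0 0 t" c0]
    by (simp_all add: flux_def)
  have i: "((\<lambda>s. (sin (\<Theta> 0 0 t s))\<^sup>2) has_integral ?A) {0..L}"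
    "((\<lambda>s. cos (\<Theta> 0 0 t s) * sin (\<Theta> 0 0 t s)) has_integral ?B) {0..L}"
    "((\<lambda>s. (cos (\<Theta> 0 0 t s))\<^sup>2) has_integral ?C) {0..L}"
    by (intro integrable_integral integrable_continuous_interval continuous_intros c)+
  have "integral {0..L} (\<lambda>s. flux_s t s * sin (\<Theta> 0 0 t s)) =
      - integral {0..L} (\<lambda>s. flux t s * (cos (\<Theta> 0 0 t s) * \<Theta> 0 1 t s))"
    by (rule integral_by_parts_periodic)
       (use L t in \<open>auto intro!: derivative_eq_intros d flux_deriv continuous_intros c continuous_flux
         simp: flux_boundary sin_cos_boundary\<close>)
  then have "((\<lambda>s. flux_s t s * sin (\<Theta> 0 0 t s)) has_integral
      - integral {0..L} (\<lambda>s. flux t s * (cos (\<Theta> 0 0 t s) * \<Theta> 0 1 t s))) {0..L}"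
    by (metis integrable_integral integrable_continuous_interval continuous_on_mult
        continuous_flux(2) t continuous_on_sin c(1))
  then have "((\<lambda>s. flux_s t s * sin (\<Theta> 0 0 t s) + (l1 t * (sin (\<Theta> 0 0 t s))\<^sup>2 -
      l2 t * (cos (\<Theta> 0 0 t s) * sin (\<Theta> 0 0 t s)))) has_integral
      - integral {0..L} (\<lambda>s. flux t s * (cos (\<Theta> 0 0 t s) * \<Theta> 0 1 t s)) + (l1 t * ?A - l2 t * ?B)) {0..L}"
    by (intro has_integral_add has_integral_diff has_integral_mult_right i)
  then have "((\<lambda>s. sin (\<Theta> 0 0 t s) * \<Theta> 1 0 t s) has_integral
      - integral {0..L} (\<lambda>s. flux t s * (cos (\<Theta> 0 0 t s) * \<Theta> 0 1 t s)) + (l1 t * ?A - l2 t * ?B)) {0..L}"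
    by (rule has_integral_eq[rotated])
       (simp add: \<theta>_equation[OF t] algebra_simps power2_eq_square)
  then show "integral {0..L} (\<lambda>s. sin (\<Theta> 0 0 t s) * \<Theta> 1 0 t s) = 0"
    by (simp add: system integral_unique)
  have "integral {0..L} (\<lambda>s. flux_s t s * cos (\<Theta> 0 0 t s)) =
      - integral {0..L} (\<lambda>s. flux t s * - (sin (\<Theta> 0 0 t s) * \<Theta> 0 1 t s))"
    by (rule integral_by_parts_periodic)
       (use L t in \<open>auto intro!: derivative_eq_intros d flux_deriv continuous_intros c continuous_flux
         simp: flux_boundary sin_cos_boundary\<close>)
  then have "((\<lambda>s. flux_s t s * cos (\<Theta> 0 0 t s)) has_integral
      integral {0..L} (\<lambda>s. flux t s * (sin (\<Theta> 0 0 t s) * \<Theta> 0 1 t s))) {0..L}"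
    by (simp add: has_integral_iff integrable_continuous_interval continuous_intros continuous_flux(2) t c)
  then have "((\<lambda>s. flux_s t s * cos (\<Theta> 0 0 t s) - (l2 t * (cos (\<Theta> 0 0 t s))\<^sup>2 -
      l1 t * (cos (\<Theta> 0 0 t s) * sin (\<Theta> 0 0 t s)))) has_integral
      integral {0..L} (\<lambda>s. flux t s * (sin (\<Theta> 0 0 t s) * \<Theta> 0 1 t s)) - (l2 t * ?C - l1 t * ?B)) {0..L}"
    by (intro has_integral_diff has_integral_mult_right i)
  then have "((\<lambda>s. cos (\<Theta> 0 0 t s) * \<Theta> 1 0 t s) has_integral
      integral {0..L} (\<lambda>s. flux t s * (sin (\<Theta> 0 0 t s) * \<Theta> 0 1 t s)) - (l2 t * ?C - l1 t * ?B)) {0..L}"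
    by (rule has_integral_eq[rotated])
       (simp add: \<theta>_equation[OF t] algebra_simps power2_eq_square)
  then show "integral {0..L} (\<lambda>s. cos (\<Theta> 0 0 t s) * \<Theta> 1 0 t s) = 0"
    by (simp add: system integral_unique)
qed

text \<open>Diffusion contributes only the boundary values of the space derivative, which cancel by
  periodicity, and \<open>lr t\<close> is the mean value that balances the reaction term.\<close>

lemma \<rho>_t_mean:
  assumes t: "0 < t"
  shows "integral {0..L} (R 1 0 t) = 0"
proof -
  have c: "continuous_on {0..L} (\<Theta> j k t)" "continuous_on {0..L} (R j k t)" for j k
    by (intro flow_continuous_intros; use t in simp)+
  let ?I = "integral {0..L} (\<lambda>s. deriv \<beta> (R 0 0 t s) * (\<Theta> 0 1 t s - c0)\<^sup>2)"
  have "lr t = - (1 / (2 * L)) * ?I"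
    unfolding lambda_rho_def using t L
    by (auto intro!: integral_cong simp: R_00 spacetime_derivatives_ds[OF \<Theta>])
  then have I: "?I = - 2 * L * lr t"
    using L by simp
  have "(R 0 2 t has_integral R 0 1 t L - R 0 1 t 0) {0..L}"
    by (rule fundamental_theorem_of_calculus)
       (use L R_s[OF t, of _ 0 1] in
         \<open>auto simp: has_real_derivative_iff_has_vector_derivative[symmetric] numeral_2_eq_2\<close>)
  then have "(R 0 2 t has_integral 0) {0..L}"
    using boundary t by simp
  moreover have "((\<lambda>s. deriv \<beta> (R 0 0 t s) * (\<Theta> 0 1 t s - c0)\<^sup>2) has_integral - 2 * L * lr t) {0..L}"
    unfolding I[symmetric]
    by (intro integrable_integral integrable_continuous_interval flow_continuous_intros c)
  moreover have "((\<lambda>s. lr t) has_integral L * lr t) {0..L}"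
    using has_integral_const_real[of "lr t" 0 L] L by simp
  ultimately have "((\<lambda>s. \<mu> * R 0 2 t s - 1 / 2 * (deriv \<beta> (R 0 0 t s) * (\<Theta> 0 1 t s - c0)\<^sup>2) - lr t)
      has_integral (\<mu> * 0 - 1 / 2 * (- 2 * L * lr t) - L * lr t)) {0..L}"
    by (intro has_integral_diff has_integral_mult_right)
  then have "(R 1 0 t has_integral (\<mu> * 0 - 1 / 2 * (- 2 * L * lr t) - L * lr t)) {0..L}"
    by (rule has_integral_eq[rotated]) (simp add: \<rho>_equation[OF t])
  then show ?thesis
    by (simp add: integral_unique)
qed

section \<open>Continuity up to the initial time and conservation of the closing integrals\<close>

lemma \<theta>_continuous: "continuous_on ({0..} \<times> {0..L}) (\<lambda>x. \<theta> (fst x) (snd x))"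
  and \<theta>_s_continuous: "continuous_on ({0..} \<times> {0..L}) (\<lambda>x. ds L (\<theta> (fst x)) (snd x))"
  and \<rho>_continuous: "continuous_on ({0..} \<times> {0..L}) (\<lambda>x. \<rho> (fst x) (snd x))"
  and \<rho>_s_continuous: "continuous_on ({0..} \<times> {0..L}) (\<lambda>x. ds L (\<rho> (fst x)) (snd x))"
proof -
  have "C0_C2 L \<theta>" "C0_C2 L \<rho>"
    using solution unfolding global_solution_def by blast+
  from this[THEN C0_C2_continuous_on, of 0] this[THEN C0_C2_continuous_on, of 1]
  show "continuous_on ({0..} \<times> {0..L}) (\<lambda>x. \<theta> (fst x) (snd x))"
    "continuous_on ({0..} \<times> {0..L}) (\<lambda>x. ds L (\<theta> (fst x)) (snd x))"
    "continuous_on ({0..} \<times> {0..L}) (\<lambda>x. \<rho> (fst x) (snd x))"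
    "continuous_on ({0..} \<times> {0..L}) (\<lambda>x. ds L (\<rho> (fst x)) (snd x))"
    by (simp_all add: One_nat_def)
qed

lemma integral_continuous:
  fixes g :: "real \<Rightarrow> real \<Rightarrow> real"
  assumes "continuous_on ({0..} \<times> {0..L}) (\<lambda>x. g (fst x) (snd x))"
  shows "continuous_on {0..} (\<lambda>t. integral {0..L} (g t))"
  using integral_continuous_on_param[of "{0..}" 0 L g] assms by (simp add: case_prod_beta')

text \<open>The rule is applied on the positive times, a convex open set, so the derivative within
  it is the full derivative.\<close>

lemma leibniz:
  fixes g :: "real \<Rightarrow> real \<Rightarrow> real"
  assumes "\<And>t s. 0 < t \<Longrightarrow> s \<in> {0..L} \<Longrightarrow> ((\<lambda>t. g t s) has_real_derivative g' t s) (at t)"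
    and "\<And>t. 0 < t \<Longrightarrow> continuous_on {0..L} (g t)"
    and "continuous_on ({0<..} \<times> {0..L}) (\<lambda>x. g' (fst x) (snd x))"
    and "0 < t"
  shows "((\<lambda>t. integral {0..L} (g t)) has_real_derivative integral {0..L} (g' t)) (at t)"
proof -
  have "((\<lambda>t. integral (cbox 0 L) (g t)) has_real_derivative integral (cbox 0 L) (g' t)) (at t within {0<..})"
    by (rule leibniz_rule_field_derivative)
       (use assms in \<open>auto simp: case_prod_beta' intro: has_field_derivative_at_within integrable_continuous_interval\<close>)
  then show ?thesis
    using at_within_open[of t "{0<..}"] \<open>0 < t\<close> by simp
qed

text \<open>For positive times the derivatives are the orthogonality integrals and vanish;
  continuity at time 0 extends the constancy to the initial datum.\<close>

lemma closing_conserved: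
  assumes t: "0 < t"
  shows "integral {0..L} (\<lambda>s. cos (\<theta> t s)) = integral {0..L} (\<lambda>s. cos (\<theta> 0 s))"
    and "integral {0..L} (\<lambda>s. sin (\<theta> t s)) = integral {0..L} (\<lambda>s. sin (\<theta> 0 s))"
proof -
  have c: "continuous_on {0..L} (\<Theta> j k t)" if "0 < t" for j k t
    by (intro flow_continuous_intros; use that in simp)
  have eq: "integral {0..L} (\<lambda>s. f (\<Theta> 0 0 t s)) = integral {0..L} (\<lambda>s. f (\<theta> t s))"
    if "0 < t" for t and f :: "real \<Rightarrow> real"
    using that by (intro integral_cong) (simp add: \<Theta>_00)
  have deriv: "((\<lambda>t. integral {0..L} (\<lambda>s. cos (\<theta> t s))) has_real_derivative 0) (at t)"
    "((\<lambda>t. integral {0..L} (\<lambda>s. sin (\<theta> t s))) has_real_derivative 0) (at t)" if t: "0 < t" for t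
  proof -
    have "((\<lambda>t. integral {0..L} (\<lambda>s. cos (\<Theta> 0 0 t s))) has_real_derivative
        integral {0..L} (\<lambda>s. - (sin (\<Theta> 0 0 t s) * \<Theta> 1 0 t s))) (at t)"
      by (rule leibniz)
         (use t \<Theta>_t[of _ _ 0 0] in \<open>auto intro!: derivative_eq_intros flow_continuous_intros c simp: mem_Times_iff\<close>)
    then have "((\<lambda>t. integral {0..L} (\<lambda>s. cos (\<Theta> 0 0 t s))) has_real_derivative 0) (at t)"
      using \<theta>_t_orthogonal[OF t] by simp
    then show "((\<lambda>t. integral {0..L} (\<lambda>s. cos (\<theta> t s))) has_real_derivative 0) (at t)"
      using t eq by (rule DERIV_cong_pos)
    have "((\<lambda>t. integral {0..L} (\<lambda>s. sin (\<Theta> 0 0 t s))) has_real_derivative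
        integral {0..L} (\<lambda>s. cos (\<Theta> 0 0 t s) * \<Theta> 1 0 t s)) (at t)"
      by (rule leibniz)
         (use t \<Theta>_t[of _ _ 0 0] in \<open>auto intro!: derivative_eq_intros flow_continuous_intros c simp: mem_Times_iff\<close>)
    then have "((\<lambda>t. integral {0..L} (\<lambda>s. sin (\<Theta> 0 0 t s))) has_real_derivative 0) (at t)"
      using \<theta>_t_orthogonal[OF t] by simp
    then show "((\<lambda>t. integral {0..L} (\<lambda>s. sin (\<theta> t s))) has_real_derivative 0) (at t)"
      using t eq by (rule DERIV_cong_pos)
  qed
  have cont: "continuous_on {0..t} (\<lambda>t. integral {0..L} (\<lambda>s. cos (\<theta> t s)))"
    "continuous_on {0..t} (\<lambda>t. integral {0..L} (\<lambda>s. sin (\<theta> t s)))"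
    by (rule continuous_on_subset[of "{0..}"], rule integral_continuous,
        intro continuous_intros \<theta>_continuous, auto)+
  show "integral {0..L} (\<lambda>s. cos (\<theta> t s)) = integral {0..L} (\<lambda>s. cos (\<theta> 0 s))"
    by (rule DERIV_isconst_end[OF t cont(1)]) (use deriv in auto)
  show "integral {0..L} (\<lambda>s. sin (\<theta> t s)) = integral {0..L} (\<lambda>s. sin (\<theta> 0 s))"
    by (rule DERIV_isconst_end[OF t cont(2)]) (use deriv in auto)
qed

section \<open>Energy dissipation and stationarity\<close>

definition E :: "real \<Rightarrow> real" where
  "E t = energy L \<mu> c0 \<beta> (\<theta> t) (\<rho> t)"

lemma E_continuous: "continuous_on {0..} E"
  unfolding E_def energy_def
  by (intro continuous_intros integral_continuous flow_continuous_intros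
      \<theta>_s_continuous \<rho>_continuous \<rho>_s_continuous)

lemma E_deriv_leibniz:
  assumes t: "0 < t"
  shows "(E has_real_derivative
    1 / 2 * integral {0..L} (\<lambda>s. deriv \<beta> (R 0 0 t s) * R 1 0 t s * (\<Theta> 0 1 t s - c0)\<^sup>2
      + 2 * (flux t s * \<Theta> 1 1 t s) + 2 * \<mu> * (R 0 1 t s * R 1 1 t s))) (at t)"
proof -
  have c: "continuous_on {0..L} (\<Theta> j k t)" "continuous_on {0..L} (R j k t)" if "0 < t" for j k t
    by (intro flow_continuous_intros; use that in simp)+
  let ?e = "\<lambda>t s. \<beta> (R 0 0 t s) * (\<Theta> 0 1 t s - c0)\<^sup>2 + \<mu> * (R 0 1 t s)\<^sup>2"
  let ?e' = "\<lambda>t s. deriv \<beta> (R 0 0 t s) * R 1 0 t s * (\<Theta> 0 1 t s - c0)\<^sup>2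
      + 2 * (flux t s * \<Theta> 1 1 t s) + 2 * \<mu> * (R 0 1 t s * R 1 1 t s)"
  have "((\<lambda>t. integral {0..L} (?e t)) has_real_derivative integral {0..L} (?e' t)) (at t)"
  proof (rule leibniz[OF _ _ _ t])
    fix t s :: real assume ts: "0 < t" "s \<in> {0..L}"
    have d: "((\<lambda>t. \<Theta> 0 1 t s) has_real_derivative \<Theta> 1 1 t s) (at t)"
      "((\<lambda>t. R 0 1 t s) has_real_derivative R 1 1 t s) (at t)"
      using \<Theta>_t[OF ts, of 0 1] R_t[OF ts, of 0 1] by simp_all
    have "((\<lambda>t. \<beta> (R 0 0 t s)) has_real_derivative deriv \<beta> (R 0 0 t s) * R 1 0 t s) (at t)"
      using DERIV_chain2[OF \<beta>_deriv R_t[OF ts, of 0 0]] by simp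
    moreover have "((\<lambda>t. (\<Theta> 0 1 t s - c0)\<^sup>2) has_real_derivative 2 * (\<Theta> 0 1 t s - c0) * \<Theta> 1 1 t s) (at t)"
      by (auto intro!: derivative_eq_intros d)
    moreover have "((\<lambda>t. \<mu> * (R 0 1 t s)\<^sup>2) has_real_derivative \<mu> * (2 * R 0 1 t s * R 1 1 t s)) (at t)"
      by (auto intro!: derivative_eq_intros d)
    ultimately have "((\<lambda>t. ?e t s) has_real_derivative
        deriv \<beta> (R 0 0 t s) * R 1 0 t s * (\<Theta> 0 1 t s - c0)\<^sup>2
        + 2 * (\<Theta> 0 1 t s - c0) * \<Theta> 1 1 t s * \<beta> (R 0 0 t s)
        + \<mu> * (2 * R 0 1 t s * R 1 1 t s)) (at t)"
      by (intro DERIV_add DERIV_mult)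
    then show "((\<lambda>t. ?e t s) has_real_derivative ?e' t s) (at t)"
      by (simp only: flux_def) (simp only: mult_ac)
  next
    show "continuous_on {0..L} (?e t)" if "0 < t" for t
      by (intro flow_continuous_intros c that)
    show "continuous_on ({0<..} \<times> {0..L}) (\<lambda>x. ?e' (fst x) (snd x))"
    proof -
      have "continuous_on ({0<..} \<times> {0..L}) (\<lambda>x. \<Theta> j k (fst x) (snd x))"
        "continuous_on ({0<..} \<times> {0..L}) (\<lambda>x. R j k (fst x) (snd x))" for j k
        by (rule spacetime_derivatives_continuous[OF \<Theta>] spacetime_derivatives_continuous[OF R];
            auto intro: continuous_intros)+
      then show ?thesis
        unfolding flux_def
        by (intro continuous_intros continuous_on_compose2[OF \<beta>_continuous _ subset_UNIV]
            continuous_on_compose2[OF \<beta>'_continuous _ subset_UNIV])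
    qed
  qed
  then have "((\<lambda>t. 1 / 2 * integral {0..L} (?e t)) has_real_derivative
      1 / 2 * integral {0..L} (?e' t)) (at t)"
    by (rule DERIV_cmult)
  then show "(E has_real_derivative 1 / 2 * integral {0..L} (?e' t)) (at t)"
    using t
  proof (rule DERIV_cong_pos)
    show "1 / 2 * integral {0..L} (?e t) = E t" if "0 < t" for t
      unfolding E_def energy_def using that L
      by (auto intro!: integral_cong simp: \<Theta>_00 R_00 spacetime_derivatives_ds[OF \<Theta>]
          spacetime_derivatives_ds[OF R])
  qed
qed

text \<open>Two integrations by parts move a space derivative off the mixed derivatives. What
  remains is the angle equation tested with \<open>\<Theta> 1 0\<close> and the density equation
  tested with \<open>R 1 0\<close>, where the multipliers do no work.\<close>

lemma dissipation_identity:
  assumes t: "0 < t"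
  shows "1 / 2 * integral {0..L} (\<lambda>s. deriv \<beta> (R 0 0 t s) * R 1 0 t s * (\<Theta> 0 1 t s - c0)\<^sup>2
      + 2 * (flux t s * \<Theta> 1 1 t s) + 2 * \<mu> * (R 0 1 t s * R 1 1 t s)) =
    - (integral {0..L} (\<lambda>s. (\<Theta> 1 0 t s)\<^sup>2) + integral {0..L} (\<lambda>s. (R 1 0 t s)\<^sup>2))"
proof -
  have c_t: "continuous_on {0..L} (\<Theta> j k t)" "continuous_on {0..L} (R j k t)" for j k
    by (intro flow_continuous_intros; use t in simp)+
  let ?e' = "\<lambda>s. deriv \<beta> (R 0 0 t s) * R 1 0 t s * (\<Theta> 0 1 t s - c0)\<^sup>2
      + 2 * (flux t s * \<Theta> 1 1 t s) + 2 * \<mu> * (R 0 1 t s * R 1 1 t s)"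
  let ?Q = "integral {0..L} (\<lambda>s. deriv \<beta> (R 0 0 t s) * R 1 0 t s * (\<Theta> 0 1 t s - c0)\<^sup>2)"
    and ?F = "integral {0..L} (\<lambda>s. flux t s * \<Theta> 1 1 t s)"
    and ?G = "integral {0..L} (\<lambda>s. R 0 1 t s * R 1 1 t s)"
  have i: "((\<lambda>s. deriv \<beta> (R 0 0 t s) * R 1 0 t s * (\<Theta> 0 1 t s - c0)\<^sup>2) has_integral ?Q) {0..L}"
    "((\<lambda>s. flux t s * \<Theta> 1 1 t s) has_integral ?F) {0..L}"
    "((\<lambda>s. R 0 1 t s * R 1 1 t s) has_integral ?G) {0..L}"
    by (intro integrable_integral integrable_continuous_interval flow_continuous_intros c_t
        continuous_flux t)+
  have e': "integral {0..L} ?e' = ?Q + 2 * ?F + 2 * \<mu> * ?G"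
    by (intro integral_unique has_integral_add has_integral_mult_right i)
  \<comment> \<open>Here \<open>\<Theta> 1 1\<close> is a space derivative of
    \<open>\<Theta> 1 0\<close>, while the Leibniz rule produced it as a time derivative of
    \<open>\<Theta> 0 1\<close>. The doubly indexed family has the symmetry of mixed derivatives
    built in.\<close>
  have d: "(\<Theta> 1 0 t has_real_derivative \<Theta> 1 1 t s) (at s within {0..L})"
    "(R 1 0 t has_real_derivative R 1 1 t s) (at s within {0..L})"
    "(R 0 1 t has_real_derivative R 0 2 t s) (at s within {0..L})" if "s \<in> {0..L}" for s
    using \<Theta>_s[OF t that, of 1 0] R_s[OF t that, of 1 0] R_s[OF t that, of 0 1] by simp_all
  have F: "integral {0..L} (\<lambda>s. flux_s t s * \<Theta> 1 0 t s) = - ?F"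
    by (rule integral_by_parts_periodic)
       (use L t in \<open>auto intro!: d flux_deriv continuous_flux c_t simp: flux_boundary boundary_t\<close>)
  have G: "integral {0..L} (\<lambda>s. R 0 2 t s * R 1 0 t s) = - ?G"
    by (rule integral_by_parts_periodic)
       (use L t in \<open>auto intro!: d c_t simp: boundary boundary_t\<close>)
  have i': "((\<lambda>s. flux_s t s * \<Theta> 1 0 t s) has_integral - ?F) {0..L}"
    "((\<lambda>s. R 0 2 t s * R 1 0 t s) has_integral - ?G) {0..L}"
    unfolding F[symmetric] G[symmetric]
    by (intro integrable_integral integrable_continuous_interval flow_continuous_intros c_t
        continuous_flux t)+
  have o: "((\<lambda>s. sin (\<Theta> 0 0 t s) * \<Theta> 1 0 t s) has_integral 0) {0..L}"
    "((\<lambda>s. cos (\<Theta> 0 0 t s) * \<Theta> 1 0 t s) has_integral 0) {0..L}"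
    "(R 1 0 t has_integral 0) {0..L}"
    by (simp_all add: has_integral_iff \<theta>_t_orthogonal \<rho>_t_mean t integrable_continuous_interval
        continuous_intros c_t)
  \<comment> \<open>The multipliers are constant in space, so each of them multiplies one of the
    vanishing integrals in \<open>o\<close>.\<close>
  have "((\<lambda>s. flux_s t s * \<Theta> 1 0 t s + (l1 t * (sin (\<Theta> 0 0 t s) * \<Theta> 1 0 t s) -
      l2 t * (cos (\<Theta> 0 0 t s) * \<Theta> 1 0 t s))) has_integral - ?F + (l1 t * 0 - l2 t * 0)) {0..L}"
    by (intro has_integral_add has_integral_diff has_integral_mult_right i' o)
  then have "((\<lambda>s. (\<Theta> 1 0 t s)\<^sup>2) has_integral - ?F + (l1 t * 0 - l2 t * 0)) {0..L}"
    by (rule has_integral_eq[rotated]) (simp add: \<theta>_equation[OF t] power2_eq_square algebra_simps)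
  moreover have "((\<lambda>s. \<mu> * (R 0 2 t s * R 1 0 t s) -
      1 / 2 * (deriv \<beta> (R 0 0 t s) * R 1 0 t s * (\<Theta> 0 1 t s - c0)\<^sup>2) - lr t * R 1 0 t s)
      has_integral \<mu> * - ?G - 1 / 2 * ?Q - lr t * 0) {0..L}"
    by (intro has_integral_diff has_integral_mult_right i i' o)
  then have "((\<lambda>s. (R 1 0 t s)\<^sup>2) has_integral \<mu> * - ?G - 1 / 2 * ?Q - lr t * 0) {0..L}"
  proof (rule has_integral_eq[rotated])
    fix s assume "s \<in> {0..L}"
    from arg_cong[OF \<rho>_equation[OF t this], of "\<lambda>z. z * R 1 0 t s"]
    show "\<mu> * (R 0 2 t s * R 1 0 t s) -
      1 / 2 * (deriv \<beta> (R 0 0 t s) * R 1 0 t s * (\<Theta> 0 1 t s - c0)\<^sup>2) - lr t * R 1 0 t s = (R 1 0 t s)\<^sup>2"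
      by (simp add: power2_eq_square[of "R 1 0 t s"] algebra_simps)
  qed
  ultimately show ?thesis
    unfolding e' by (simp add: integral_unique)
qed

lemma E_deriv:
  assumes t: "0 < t"
  shows "(E has_real_derivative
    - (integral {0..L} (\<lambda>s. (\<Theta> 1 0 t s)\<^sup>2) + integral {0..L} (\<lambda>s. (R 1 0 t s)\<^sup>2))) (at t)"
  by (rule E_deriv_leibniz[OF t, unfolded dissipation_identity[OF t]])

text \<open>The case \<open>a = 0\<close> is included: the sign of the derivative is used only
  inside the interval, and continuity takes care of the ends.\<close>

lemma E_antimono:
  assumes "0 \<le> a" "a \<le> b"
  shows "E b \<le> E a"
proof (rule DERIV_nonpos_imp_decreasing_open[OF \<open>a \<le> b\<close>])
  have c: "continuous_on {0..L} (\<Theta> j k t)" "continuous_on {0..L} (R j k t)" if "0 < t" for j k t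
    by (intro flow_continuous_intros; use that in simp)+
  fix t assume "a < t"
  then have t: "0 < t"
    using assms by simp
  have "0 \<le> integral {0..L} (\<lambda>s. (\<Theta> 1 0 t s)\<^sup>2)" "0 \<le> integral {0..L} (\<lambda>s. (R 1 0 t s)\<^sup>2)"
    by (intro integral_nonneg integrable_continuous_interval continuous_intros c t; simp)+
  then show "\<exists>y. DERIV E t :> y \<and> y \<le> 0"
    using E_deriv[OF t] by (intro exI conjI) auto
next
  show "continuous_on {a..b} E"
    using E_continuous by (rule continuous_on_subset) (use assms in auto)
qed

text \<open>Without a loss of energy the dissipation vanishes at every intermediate time. A
  continuous square with integral 0 is identically 0, so the angle does not move at any point of the
  interval.\<close>

lemma stationary:
  assumes t: "0 < t" and "E 0 \<le> E t" and s: "s \<in> {0..L}"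
  shows "\<theta> t s = \<theta> 0 s"
proof (rule DERIV_isconst_end[OF t])
  have "continuous_on {0..t} (\<lambda>\<tau>. \<theta> (fst (\<tau>, s)) (snd (\<tau>, s)))"
    by (rule continuous_on_compose2[OF \<theta>_continuous]) (use s in \<open>auto intro!: continuous_intros\<close>)
  then show "continuous_on {0..t} (\<lambda>\<tau>. \<theta> \<tau> s)"
    by simp
  fix \<tau> assume \<tau>: "0 < \<tau>" "\<tau> < t"
  have c: "continuous_on {0..L} (\<Theta> 1 0 \<tau>)" "continuous_on {0..L} (R 1 0 \<tau>)"
    by (intro flow_continuous_intros; use \<tau> in simp)+
  \<comment> \<open>By monotonicity \<open>E r\<close> lies between \<open>E t\<close> and
    \<open>E 0\<close>, and the hypothesis closes the gap.\<close>
  have const: "E 0 = E r" if "r \<in> {0..t}" for r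
    using E_antimono[of 0 r] E_antimono[of r t] that assms by force
  have "(E has_real_derivative 0) (at \<tau>)"
    by (rule has_field_derivative_transform_within_open[of "\<lambda>_. E 0" _ _ "{0<..<t}"])
       (use \<tau> const in auto)
  then have "integral {0..L} (\<lambda>s. (\<Theta> 1 0 \<tau> s)\<^sup>2) + integral {0..L} (\<lambda>s. (R 1 0 \<tau> s)\<^sup>2) = 0"
    using DERIV_unique[OF E_deriv[OF \<tau>(1)]] by force
  moreover have "0 \<le> integral {0..L} (\<lambda>s. (\<Theta> 1 0 \<tau> s)\<^sup>2)" "0 \<le> integral {0..L} (\<lambda>s. (R 1 0 \<tau> s)\<^sup>2)"
    by (intro integral_nonneg integrable_continuous_interval continuous_intros c; simp)+
  ultimately have "integral {0..L} (\<lambda>s. (\<Theta> 1 0 \<tau> s)\<^sup>2) = 0"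
    by linarith
  then have "\<Theta> 1 0 \<tau> s = 0"
    using integral_eq_0_iff[of 0 L "\<lambda>s. (\<Theta> 1 0 \<tau> s)\<^sup>2"] L s c by (simp add: continuous_intros)
  then show "((\<lambda>\<tau>. \<theta> \<tau> s) has_real_derivative 0) (at \<tau>)"
    using spacetime_derivatives_deriv[OF \<Theta> \<tau>(1) s] by simp
qed

end

section \<open>Preservation of embeddedness\<close>

theorem proposition3p11:
  fixes L \<nu> \<mu> c0 :: real and \<omega> :: int
    and \<beta> \<theta>0 \<rho>0 :: "real \<Rightarrow> real"
    and \<theta> \<rho> :: "real \<Rightarrow> real \<Rightarrow> real"
  assumes "L > 0" and "\<mu> > 0"
    and "smooth_real \<beta>" and "\<forall>x. \<beta> x > 0"
    and "admissible_datum L \<nu> \<omega> \<theta>0 \<rho>0"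
    and "global_solution L \<mu> \<omega> c0 \<beta> \<theta>0 \<rho>0 \<theta> \<rho>"
    and "describes_embedded L \<theta>0"
    and "\<omega> = 1"
    and "energy L \<mu> c0 \<beta> \<theta>0 \<rho>0 \<le> (INF x. \<beta> x) / 2 * (C2T / L - 4 * pi * c0 + L * c0\<^sup>2)"
  shows "\<forall>t>0. describes_embedded L (\<theta> t)"
proof -
  have "smooth_spacetime L \<theta>" "smooth_spacetime L \<rho>"
    using assms(6) unfolding global_solution_def by blast+
  then obtain \<Theta> R where "spacetime_derivatives L \<theta> \<Theta>" "spacetime_derivatives L \<rho> R"
    unfolding smooth_spacetime_iff by blast
  then interpret elastic_flow L \<mu> c0 \<omega> \<beta> \<theta>0 \<rho>0 \<theta> \<rho> \<Theta> R
    using assms by unfold_locales auto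
  have init: "\<theta> 0 s = \<theta>0 s" "\<rho> 0 s = \<rho>0 s" if "s \<in> {0..L}" for s
    using solution that unfolding global_solution_def by blast+
  have E_0: "E 0 = energy L \<mu> c0 \<beta> \<theta>0 \<rho>0"
  proof -
    have "ds L (\<theta> 0) s = ds L \<theta>0 s" "ds L (\<rho> 0) s = ds L \<rho>0 s" if "s \<in> {0..L}" for s
      using that init by (auto intro!: ds_cong)
    then show ?thesis
      unfolding E_def energy_def by (auto intro!: integral_cong simp: init)
  qed
  show ?thesis
  proof (intro allI impI, rule ccontr)
    fix t :: real assume t: "0 < t" and not_embedded: "\<not> describes_embedded L (\<theta> t)"
    have d\<theta>: "(\<theta> t has_real_derivative \<Theta> 0 1 t s) (at s within {0..L})" if "s \<in> {0..L}" for s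
    proof (rule has_field_derivative_transform_within[of _ _ s "{0..L}" 1])
      show "(\<Theta> 0 0 t has_real_derivative \<Theta> 0 1 t s) (at s within {0..L})"
        using \<Theta>_s[OF t that, of 0 0] by simp
    qed (use that \<Theta>_00[OF t] in auto)
    have c\<kappa>: "continuous_on {0..L} (\<Theta> 0 1 t)"
      by (intro flow_continuous_intros; use t in simp)
    have "continuous_on {0..L} (\<lambda>s. \<rho> (fst (t, s)) (snd (t, s)))"
      "continuous_on {0..L} (\<lambda>s. ds L (\<rho> (fst (t, s))) (snd (t, s)))"
      by (rule continuous_on_compose2[OF \<rho>_continuous] continuous_on_compose2[OF \<rho>_s_continuous];
          use t in \<open>auto intro!: continuous_intros\<close>)+
    then have c\<rho>: "continuous_on {0..L} (\<rho> t)" "continuous_on {0..L} (ds L (\<rho> t))"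
      by simp_all
    have c\<theta>: "continuous_on {0..L} (\<theta> t)"
      using DERIV_continuous_on[of "{0..L}" "\<theta> t" "\<Theta> 0 1 t"] d\<theta> by auto
    have winding: "\<theta> t L - \<theta> t 0 = 2 * pi"
      using solution t \<open>\<omega> = 1\<close> unfolding global_solution_def by simp
    have "integral {0..L} (\<lambda>s. cos (\<theta> 0 s)) = integral {0..L} (\<lambda>s. cos (\<theta>0 s))"
      "integral {0..L} (\<lambda>s. sin (\<theta> 0 s)) = integral {0..L} (\<lambda>s. sin (\<theta>0 s))"
      by (auto intro!: integral_cong simp: init)
    then have closed: "curve_of 0 (\<theta> t) L = curve_of 0 (\<theta> t) 0"
      using assms(5) closing_conserved[OF t]
      unfolding closed_curve_iff[OF L c\<theta>] admissible_datum_def by simp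
    \<comment> \<open>Since the curve closes up, it can fail to be embedded only through a
      self-intersection.\<close>
    then have "C2T \<le> L * integral {0..L} (\<lambda>s. (\<Theta> 0 1 t s)\<^sup>2)"
      using not_embedded describes_embedded_iff
      by (intro C2T_le_length_bending[OF L d\<theta> c\<kappa> winding]) auto
    then have "C2T / L \<le> integral {0..L} (\<lambda>s. (\<Theta> 0 1 t s)\<^sup>2)"
      using L by (simp add: field_simps)
    \<comment> \<open>The infimum of a positive function may be 0, so the comparison is by
      monotonicity and never divides by it.\<close>
    moreover have "0 \<le> (INF x. \<beta> x)"
      using assms(4) by (intro cINF_greatest) (auto intro: less_imp_le)
    ultimately have "(INF x. \<beta> x) / 2 * (C2T / L - 4 * pi * c0 + L * c0\<^sup>2) \<le>
        (INF x. \<beta> x) / 2 * (integral {0..L} (\<lambda>s. (\<Theta> 0 1 t s)\<^sup>2) - 4 * pi * c0 + L * c0\<^sup>2)"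
      by (intro mult_left_mono) auto
    also have "\<dots> \<le> E t"
      unfolding E_def using assms(2,4)
      by (intro energy_ge_bending[OF L _ _ \<beta>_continuous d\<theta> c\<kappa> c\<rho> winding]) auto
    finally have "E 0 \<le> E t"
      using assms(9) E_0 by linarith
    \<comment> \<open>Agreement on \<open>{0..L}\<close> is enough, because the described curve
      depends on the angle only there.\<close>
    then have "\<theta> t s = \<theta>0 s" if "s \<in> {0..L}" for s
      using stationary[OF t] init that by simp
    then show False
      using describes_embedded_cong[OF L, of "\<theta> t" \<theta>0] assms(7) not_embedded by simp
  qed
qed

end
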